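(* Let $N\ge1$, $1<p<\infty$ and $0<s<1$, let $\Omega\subset\mathbb{R}^N$ be a bounded open set with Lipschitz boundary, and assume that $\mathrm{diam}(\Omega)<e^{-\frac1{sp}}$ and $B(N,s,p)\ge0$. Let $x_0\in\Omega$ and let $u\in W^{s+\log,p}_0(\Omega)$ be a supersolution of the problem $(-\Delta)^{s+\log}_pu=0$ in $\Omega$, $u=0$ in $\mathbb{R}^N\setminus\Omega$, such that $u\ge0$ in $\mathcal{B}_R(x_0)\Subset\Omega$. Then, for every $0<\delta<1$ and $r>0$ such that $\mathcal{B}_{2r}(x_0)\subset\mathcal{B}_{\frac R2}(x_0)$, one has $$\begin{aligned}&\int_{\mathcal{B}_{2r}(x_0)}\int_{\mathcal{B}_{2r}(x_0)}\mathbf{K}^{s+\log}_p(|x-y|)\left|\ln\left(\frac{\delta+u(x)}{\delta+u(y)}\right)\right|^p\,dx\,dy\\&\le C\,r^{N-sp}\Bigg\{C(N,s,p)\,\omega_N^2\,2^{2N}\left[\frac{B(N,s,p)-p\ln r}{sp}-\frac1{s^2p}\right]\\&\quad+\omega_N2^N\int_{\mathbb{R}^N\setminus\mathcal{B}_R(x_0)}\Big(\mathbf{K}^{s+\log}_p\big(\tfrac12|y-x_0|\big)\Big)_+\big(u(y)\big)_-^{p-1}\,dy\\&\quad+c\,C(N,s,p)\,\frac{\omega_N^2}{Np(1-s)}\,2^{N+2p(1-s)}\left[B(N,s,p)-p\ln(4r)+\frac1{1-s}\right]\Bigg\},\end{aligned}$$ where $C,c>0$ are universal constants depending only on $p$.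
   Context: $\mathcal{B}_\rho(x_0)$ is the open ball of radius $\rho$ centered at $x_0$; $(a)_\pm=\max\{0,\pm a\}$; $\omega_N=\frac{2\pi^{N/2}}{\Gamma(N/2)}$ is the surface measure of the unit sphere; $\mathrm{diam}(\Omega)=\sup\{|x-y|:x,y\in\Omega\}$; $\psi=\Gamma'/\Gamma$; $$C(N,s,p)=\begin{cases}\dfrac{s\,p\,2^{2(s-1)}\,\Gamma\left(\frac{N+sp}{2}\right)}{\pi^{\frac{N-1}{2}}\,\Gamma(1-s)\,\Gamma\left(\frac{p+1}{2}\right)}, & s>\tfrac12,\\[8pt]\dfrac{s\,p\,2^{2s-1}\,\Gamma\left(\frac{N+sp}{2}\right)}{\pi^{\frac N2}\,\Gamma(1-s)}, & s\le\tfrac12,\end{cases}\qquad B(N,s,p)=2\ln2+\frac1s+\frac p2\psi\Big(\frac{N+sp}{2}\Big)+\psi(1-s).$$ The full kernel is $\mathbf{K}^{s+\log}_p(\rho):=\dfrac{B(N,s,p)C(N,s,p)-p\,C(N,s,p)\ln\rho}{\rho^{N+sp}}$, $\rho>0$. $W^{s+\log,p}_0(\Omega)$ is the space of real-valued $u\in L^p(\mathbb{R}^N)$ with $u=0$ a.e. in $\mathbb{R}^N\setminus\Omega$ and $\iint_{\mathbb{R}^{2N}}|u(x)-u(y)|^p\frac{C(N,s,p)(-\ln|x-y|)_+}{|x-y|^{N+sp}}\,dx\,dy<\infty$. A function $u\in W^{s+\log,p}_0(\Omega)$ is a supersolution if $\mathcal{J}_{s+\log,p}(u,\varphi)\ge0$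 for all $\varphi\in W^{s+\log,p}_0(\Omega)$ with $\varphi\ge0$, where $$\mathcal{J}_{s+\log,p}(u,\varphi)=\frac12\iint_{\mathbb{R}^{2N}}|u(x)-u(y)|^{p-2}(u(x)-u(y))(\varphi(x)-\varphi(y))\,\mathbf{K}^{s+\log}_p(|x-y|)\,dx\,dy.$$ *)

theory Defs
  imports "HOL-Analysis.Analysis"
begin

section \<open>Euclidean space of variable dimension\<close>

text \<open>The constants of the theorem may depend on \<open>p\<close> only, so the dimension \<open>N\<close> is quantified
  inside the statement and cannot be a type. Points of \<open>R^N\<close> are the extensional functions on
  \<open>{..<N}\<close>, i.e. the common carrier of the library's product topology and product measure.
  Every measurable class modulo null sets has a Borel representative, so the Borel-measurable
  functions with respect to \<^term>\<open>Pi\<^sub>M {..<N} (\<lambda>_. lborel)\<close> suffice.\<close>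

definition eucl :: "nat \<Rightarrow> (nat \<Rightarrow> real) set" where
  "eucl N = ({..<N} \<rightarrow>\<^sub>E UNIV)"

definition eucl_top :: "nat \<Rightarrow> (nat \<Rightarrow> real) topology" where
  "eucl_top N = product_topology (\<lambda>_. euclideanreal) {..<N}"

definition leb :: "nat \<Rightarrow> (nat \<Rightarrow> real) measure" where
  "leb N = Pi\<^sub>M {..<N} (\<lambda>_. lborel)"

definition edist :: "nat \<Rightarrow> (nat \<Rightarrow> real) \<Rightarrow> (nat \<Rightarrow> real) \<Rightarrow> real" where
  "edist N x y = L2_set (\<lambda>i. x i - y i) {..<N}"

definition open_ball :: "nat \<Rightarrow> (nat \<Rightarrow> real) \<Rightarrow> real \<Rightarrow> (nat \<Rightarrow> real) set" where
  "open_ball N x \<rho> = {y \<in> eucl N. edist N x y < \<rho>}"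

definition ebounded :: "nat \<Rightarrow> (nat \<Rightarrow> real) set \<Rightarrow> bool" where
  "ebounded N S \<longleftrightarrow> (\<exists>M. \<forall>x\<in>S. \<forall>y\<in>S. edist N x y \<le> M)"

definition ediam :: "nat \<Rightarrow> (nat \<Rightarrow> real) set \<Rightarrow> real" where
  "ediam N S = (SUP (x, y)\<in>S \<times> S. edist N x y)"

text \<open>Near each boundary point, after a Euclidean isometry \<open>T\<close> of \<open>R^N\<close>, the set is the part above
  the graph of a Lipschitz function \<open>\<gamma>\<close> of the first \<open>N - 1\<close> coordinates. For \<open>N = 1\<close> the domain of
  \<open>\<gamma>\<close> is a single point, so the set is locally an open half-line.\<close>

definition lipschitz_boundary :: "nat \<Rightarrow> (nat \<Rightarrow> real) set \<Rightarrow> bool" where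
  "lipschitz_boundary N \<Omega> \<longleftrightarrow>
     (\<forall>z \<in> eucl_top N frontier_of \<Omega>. \<exists>\<rho>>0. \<exists>T \<gamma> L.
        bij_betw T (eucl N) (eucl N) \<and>
        (\<forall>x\<in>eucl N. \<forall>y\<in>eucl N. edist N (T x) (T y) = edist N x y) \<and>
        (\<forall>x\<in>eucl (N - 1). \<forall>y\<in>eucl (N - 1). \<bar>\<gamma> x - \<gamma> y\<bar> \<le> L * edist (N - 1) x y) \<and>
        \<Omega> \<inter> open_ball N z \<rho> = {x \<in> open_ball N z \<rho>. T x (N - 1) > \<gamma> (restrict (T x) {..<N - 1})})"

section \<open>The constants and the kernel\<close>

definition sphere_area :: "nat \<Rightarrow> real" where
  "sphere_area N = 2 * pi powr (real N / 2) / Gamma (real N / 2)"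

definition C_const :: "nat \<Rightarrow> real \<Rightarrow> real \<Rightarrow> real" where
  "C_const N s p =
     (if s > 1/2
      then s * p * 2 powr (2 * (s - 1)) * Gamma ((real N + s * p) / 2)
             / (pi powr ((real N - 1) / 2) * Gamma (1 - s) * Gamma ((p + 1) / 2))
      else s * p * 2 powr (2 * s - 1) * Gamma ((real N + s * p) / 2)
             / (pi powr (real N / 2) * Gamma (1 - s)))"

definition B_const :: "nat \<Rightarrow> real \<Rightarrow> real \<Rightarrow> real" where
  "B_const N s p =
     2 * ln 2 + 1 / s + p / 2 * Digamma ((real N + s * p) / 2) + Digamma (1 - s)"

definition log_kernel :: "nat \<Rightarrow> real \<Rightarrow> real \<Rightarrow> real \<Rightarrow> real" where
  "log_kernel N s p \<rho> =
     (B_const N s p * C_const N s p - p * C_const N s p * ln \<rho>) / \<rho> powr (real N + s * p)"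

section \<open>The function space and supersolutions\<close>

definition W0 :: "nat \<Rightarrow> real \<Rightarrow> real \<Rightarrow> (nat \<Rightarrow> real) set \<Rightarrow> ((nat \<Rightarrow> real) \<Rightarrow> real) set" where
  "W0 N s p \<Omega> = {u.
     u \<in> borel_measurable (leb N) \<and>
     integrable (leb N) (\<lambda>x. \<bar>u x\<bar> powr p) \<and>
     (AE x in leb N. x \<notin> \<Omega> \<longrightarrow> u x = 0) \<and>
     integrable (leb N \<Otimes>\<^sub>M leb N)
       (\<lambda>(x, y). \<bar>u x - u y\<bar> powr p *
          (C_const N s p * max 0 (- ln (edist N x y)) / edist N x y powr (real N + s * p)))}"

text \<open>For \<open>p < 2\<close>, the expression \<open>|t|^(p-2) t\<close> is understood as \<open>0\<close> at \<open>t = 0\<close>. The integrand is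
  absolutely integrable whenever \<open>u\<close> and \<open>\<phi>\<close> belong to \<^const>\<open>W0\<close>.\<close>

definition J_form ::
  "nat \<Rightarrow> real \<Rightarrow> real \<Rightarrow> ((nat \<Rightarrow> real) \<Rightarrow> real) \<Rightarrow> ((nat \<Rightarrow> real) \<Rightarrow> real) \<Rightarrow> real" where
  "J_form N s p u \<phi> =
     1 / 2 * (\<integral>(x, y). \<bar>u x - u y\<bar> powr (p - 2) * (u x - u y) * (\<phi> x - \<phi> y)
                * log_kernel N s p (edist N x y) \<partial>(leb N \<Otimes>\<^sub>M leb N))"

definition supersolution ::
  "nat \<Rightarrow> real \<Rightarrow> real \<Rightarrow> (nat \<Rightarrow> real) set \<Rightarrow> ((nat \<Rightarrow> real) \<Rightarrow> real) \<Rightarrow> bool" where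
  "supersolution N s p \<Omega> u \<longleftrightarrow>
     u \<in> W0 N s p \<Omega> \<and>
     (\<forall>\<phi>\<in>W0 N s p \<Omega>. (AE x in leb N. 0 \<le> \<phi> x) \<longrightarrow> 0 \<le> J_form N s p u \<phi>)"

end

theory Submission
  imports Defs
begin

text \<open>Why the estimate holds. Write \<open>X = B - p ln r\<close> for the number that governs the kernel
  at scale \<open>r\<close>. Two facts about the kernel \<open>K\<close> drive everything. It is nonnegative on \<open>[0, 1]\<close>, hence
  between any two points of \<open>\<Omega>\<close>, because \<open>B \<ge> 0\<close> and the diameter is below \<open>1\<close>. It is negative far away,
  but its integral over \<open>|z| \<ge> a\<close> is \<open>\<omega> C a^(-sp) / (sp) * (B - p ln a - 1/s)\<close>, which is positive exactly
  when \<open>a\<close> is so small that \<open>p ln a < B - 1/s\<close>; the bound \<open>e^(-1/(sp))\<close> on the diameter ensures this for a number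
  \<open>d\<close> slightly larger than the diameter. So pairs at distance at least \<open>d\<close>, of which at most one
  point lies in \<open>\<Omega>\<close>, can be treated as if the kernel were positive there: the integrands below depend
  on the point in \<open>\<Omega>\<close> only, so that just the integral of the kernel matters.

  The first consequence is a weak maximum principle (\<open>supersolution_nonneg\<close>): testing with the
  negative part of \<open>u\<close> shows that \<open>u \<ge> 0\<close> almost everywhere on the whole space. Thus the tail
  integral on the right-hand side vanishes, and it is enough to bound the left-hand side by the
  first of the three terms, the other two being nonnegative. This also explains why no negative
  power of \<open>\<delta>\<close> appears in front of the tail.

  The second step is the classical logarithmic estimate. Test with
  \<open>\<eta>^p (\<delta> + u)^(1-p)\<close>, where the cutoff \<open>\<eta>\<close> is \<open>1\<close> on the ball of radius \<open>2r\<close>, vanishes off the ball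
  of radius \<open>3r\<close> and has slope \<open>1/r\<close>. A discrete Picone inequality (\<open>discrete_picone\<close>) bounds the integrand by
  \<open>|\<eta>(x) - \<eta>(y)|^p K\<close>, and where \<open>\<eta>(x) = \<eta>(y) = 1\<close> the integrand is at most
  \<open>-(p-1)/2 * |ln ((\<delta> + u(x)) / (\<delta> + u(y)))|^p K\<close> (\<open>log_increment_le\<close>). Integration in polar
  coordinates leaves the mass of \<open>K\<close> over \<open>|z| \<ge> r\<close>, which is the first term of the claim, and the
  near mass of \<open>(|z|/r)^p K\<close> over \<open>|z| < r\<close>, all multiplied by the volume of the ball of radius
  \<open>3r\<close> (\<open>log_oscillation_energy\<close>).

  The constants must depend on \<open>p\<close> only. The factor \<open>3^N\<close> from the volume of the large ball is
  dominated by the \<open>4^N\<close> in the first term, with exponential room. The near mass has an additional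
  factor of order \<open>(1 - s)^(-2)\<close>. Since \<open>\<psi>(1 - s)\<close> behaves like \<open>-1/(1 - s)\<close> as \<open>s\<close> tends to \<open>1\<close>, the
  hypothesis \<open>B \<ge> 0\<close> forces \<open>1/(1 - s)\<close> to be at most linear in \<open>N\<close>
  (\<open>inverse_one_minus_s_le\<close>), so the exponential room absorbs it (\<open>near_term_absorbed\<close>).\<close>

section \<open>Elementary inequalities\<close>

text \<open>Convexity of \<open>t^p\<close>, applied to \<open>m = (1 - \<eta>) * (n / (1 - \<eta>)) + \<eta> * ((m - n) / \<eta>)\<close>.\<close>

lemma powr_convex_combination_quotient:
  fixes m n \<eta> p :: real
  assumes p: "1 < p" and n: "0 \<le> n" "n < m" and \<eta>: "0 < \<eta>" "\<eta> < 1"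
  shows "m powr p \<le> n powr p * (1 - \<eta>) powr (1 - p) + (m - n) powr p * \<eta> powr (1 - p)"
proof (cases "n = 0")
  case True
  have "1 \<le> \<eta> powr (1 - p)"
    using powr_mono2'[of "1-p" \<eta> 1] p \<eta> by simp
  then show ?thesis using True n by (simp add: mult_le_cancel_left1)
next
  case False
  then have n0: "0 < n" using n by simp
  have "((1 - \<eta>) *\<^sub>R (n / (1 - \<eta>)) + \<eta> *\<^sub>R ((m - n) / \<eta>)) powr p
        \<le> (1 - \<eta>) * (n / (1 - \<eta>)) powr p + \<eta> * ((m - n) / \<eta>) powr p"
    by (rule convex_onD[OF powr_convex]) (use n0 n \<eta> p in auto)
  moreover have "(1 - \<eta>) *\<^sub>R (n / (1 - \<eta>)) + \<eta> *\<^sub>R ((m - n) / \<eta>) = m"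
    using \<eta> by simp
  moreover have "(1 - \<eta>) * (n / (1 - \<eta>)) powr p = n powr p * (1 - \<eta>) powr (1 - p)"
    using n0 \<eta> by (simp add: powr_divide powr_diff)
  moreover have "\<eta> * ((m - n) / \<eta>) powr p = (m - n) powr p * \<eta> powr (1 - p)"
    using n \<eta> by (simp add: powr_divide powr_diff)
  ultimately show ?thesis by simp
qed

text \<open>The quantity behind the test function \<open>\<eta>^p u^(1-p)\<close>. Only \<open>n < m\<close> is of interest, for otherwise the left-hand side is nonpositive. The
  ratio \<open>(a - b) / a\<close> is then the right weight in the convexity inequality above: with it the powers of
  \<open>a\<close> and \<open>b\<close> cancel completely, which gives the constant \<open>1\<close>.\<close>

lemma discrete_picone:
  fixes a b m n p :: real
  assumes p: "1 < p" and ab: "0 < b" "b \<le> a" and mn: "0 \<le> m" "0 \<le> n"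
  shows "(a - b) powr (p - 1) * (m powr p * a powr (1 - p) - n powr p * b powr (1 - p))
         \<le> \<bar>m - n\<bar> powr p"
proof (cases "m \<le> n \<or> a = b")
  case True
  then have "(a - b) powr (p - 1) * (m powr p * a powr (1 - p) - n powr p * b powr (1 - p)) \<le> 0"
  proof
    assume "m \<le> n"
    then have "m powr p \<le> n powr p" using p mn by (intro powr_mono2) auto
    moreover have "a powr (1 - p) \<le> b powr (1 - p)" using p ab by (intro powr_mono2') auto
    ultimately show ?thesis
      by (intro mult_nonneg_nonpos) (auto intro!: mult_mono)
  qed simp
  then show ?thesis by (rule order_trans) simp
next
  case False
  define \<eta> where "\<eta> = (a - b) / a"
  have \<eta>: "0 < \<eta>" "\<eta> < 1" "1 - \<eta> = b / a" using False ab by (auto simp: \<eta>_def field_simps)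
  have "(a - b) powr (p - 1) * (m powr p * a powr (1 - p) - n powr p * b powr (1 - p))
      = \<eta> powr (p - 1) * (m powr p - n powr p * (1 - \<eta>) powr (1 - p))"
    unfolding \<eta>(3) using ab False p
    by (simp add: \<eta>_def powr_divide powr_diff field_simps)
  also have "\<dots> \<le> \<eta> powr (p - 1) * ((m - n) powr p * \<eta> powr (1 - p))"
    using powr_convex_combination_quotient[OF p, of n m \<eta>] mn False \<eta>
    by (intro mult_left_mono) auto
  also have "\<dots> = (m - n) powr p"
    using \<eta> by (simp add: powr_diff)
  finally show ?thesis using False by simp
qed

lemma two_sinh_ge:
  fixes v :: real
  assumes "0 \<le> v"
  shows "v \<le> exp (v / 2) - exp (- v / 2)"
proof -
  have "(\<lambda>v. exp (v / 2) - exp (- v / 2) - v) 0 \<le> (\<lambda>v::real. exp (v / 2) - exp (- v / 2) - v) v"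
  proof (rule DERIV_nonneg_imp_nondecreasing[OF assms], intro exI conjI)
    fix x :: real
    show "((\<lambda>v. exp (v / 2) - exp (- v / 2) - v) has_real_derivative
            (exp (x / 2) + exp (- x / 2)) / 2 - 1) (at x)"
      by (auto intro!: derivative_eq_intros simp: field_simps)
    have "exp (x / 2) * exp (- x / 2) = 1" by (simp flip: exp_add)
    then show "0 \<le> (exp (x / 2) + exp (- x / 2)) / 2 - 1"
      using arith_geo_mean_sqrt[of "exp (x / 2)" "exp (- x / 2)"] by simp
  qed
  then show ?thesis by simp
qed

text \<open>With \<open>v = ln (a / b)\<close> and \<open>w = (p - 1) v\<close> the right-hand side is \<open>(e^v - 1)^(p-1) * (1 - e^(-w))\<close>.
  The bounds \<open>e^v - 1 \<ge> v e^(v/2)\<close> and \<open>1 - e^(-w) \<ge> w / (1 + w)\<close> hold for all \<open>v \<ge> 0\<close>, and the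
  factor \<open>e^(w/2) \<ge> (1 + w) / 2\<close> that the former provides compensates the denominator of the latter; so one
  argument covers small and large \<open>v\<close>.\<close>

lemma log_increment_le:
  fixes a b p :: real
  assumes p: "1 < p" and ab: "0 < b" "b \<le> a"
  shows "(p - 1) / 2 * ln (a / b) powr p
         \<le> (a - b) powr (p - 1) * (b powr (1 - p) - a powr (1 - p))"
proof (cases "a = b")
  case False
  define v w where "v = ln (a / b)" and "w = (p - 1) * v"
  have v: "0 < v" "a = b * exp v" using ab False by (auto simp: v_def)
  have w: "0 < w" using v p by (simp add: w_def)
  have "v * exp (v / 2) \<le> (exp (v / 2) - exp (- v / 2)) * exp (v / 2)"
    using two_sinh_ge[of v] v by (intro mult_right_mono) auto
  also have "\<dots> = exp v - 1" by (simp add: algebra_simps flip: exp_add)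
  finally have "(v * exp (v / 2)) powr (p - 1) \<le> (exp v - 1) powr (p - 1)"
    using v p by (intro powr_mono2) auto
  moreover have "(v * exp (v / 2)) powr (p - 1) = v powr (p - 1) * exp (w / 2)"
    using v by (simp add: powr_mult w_def exp_powr_real mult.commute)
  moreover have "1 + w / 2 \<le> exp (w / 2)" by (rule exp_ge_add_one_self)
  ultimately have "v powr (p - 1) * exp (w / 2) \<le> (exp v - 1) powr (p - 1)"
    and "(1 + w) / 2 \<le> exp (w / 2)"
    by (simp_all add: field_simps)
  then have 1: "v powr (p - 1) * ((1 + w) / 2) \<le> (exp v - 1) powr (p - 1)"
    using mult_left_mono[of "(1 + w) / 2" "exp (w / 2)" "v powr (p - 1)"] by simp
  have "exp (- w) \<le> 1 / (1 + w)"
    using exp_ge_add_one_self[of w] w by (simp add: exp_minus field_simps)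
  then have 2: "w / (1 + w) \<le> 1 - exp (- w)" using w by (simp add: field_simps)
  have "(p - 1) / 2 * v powr p = v powr (p - 1) * ((1 + w) / 2) * (w / (1 + w))"
  proof -
    have "v powr (p - 1) * v = v powr p" using v powr_add[of v "p - 1" 1] by simp
    then have "(p - 1) / 2 * v powr p = v powr (p - 1) * (w / 2)" by (simp add: w_def)
    also have "w / 2 = (1 + w) / 2 * (w / (1 + w))" using w by (simp add: divide_simps)
    finally show ?thesis by (simp only: mult.assoc)
  qed
  also have "\<dots> \<le> (exp v - 1) powr (p - 1) * (1 - exp (- w))"
    using 1 2 w by (intro mult_mono) auto
  also have "\<dots> = (a - b) powr (p - 1) * (b powr (1 - p) - a powr (1 - p))"
  proof -
    have "a - b = b * (exp v - 1)" using v by (simp add: algebra_simps)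
    then have "(a - b) powr (p - 1) = b powr (p - 1) * (exp v - 1) powr (p - 1)"
      using ab v by (simp add: powr_mult)
    moreover have "a powr (1 - p) = b powr (1 - p) * exp (- w)"
      using ab v by (simp add: powr_mult w_def exp_powr_real algebra_simps)
    moreover have "b powr (p - 1) * b powr (1 - p) = 1" using ab by (simp flip: powr_add)
    moreover have "(b powr (p - 1) * (exp v - 1) powr (p - 1)) * (b powr (1 - p) - b powr (1 - p) * exp (- w))
      = (b powr (p - 1) * b powr (1 - p)) * ((exp v - 1) powr (p - 1) * (1 - exp (- w)))"
      by (simp only: right_diff_distrib left_diff_distrib mult_1_right mult_1_left mult_ac)
    ultimately show ?thesis by (simp only: mult_1_left)
  qed
  finally show ?thesis by (simp add: v_def)
qed simp

lemma powr_young: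
  fixes a b p :: real
  assumes "1 < p" "0 \<le> a" "0 \<le> b"
  shows "a powr (p - 1) * b \<le> a powr p + b powr p"
proof (cases "b \<le> a")
  case True
  have "a powr (p - 1) * b \<le> a powr (p - 1) * a" using True by (intro mult_left_mono) auto
  also have "\<dots> = a powr p" using assms by (cases "a = 0") (auto simp: powr_diff)
  finally show ?thesis by (simp add: add_increasing2)
next
  case False
  have "a powr (p - 1) * b \<le> b powr (p - 1) * b" using False assms by (intro mult_right_mono powr_mono2) auto
  also have "\<dots> = b powr p" using assms False by (auto simp: powr_diff)
  finally show ?thesis by (simp add: add_increasing)
qed

lemma powr_abs_diff_le:
  fixes a b p :: real
  assumes "1 < p"
  shows "\<bar>a - b\<bar> powr p \<le> 2 powr p * (\<bar>a\<bar> powr p + \<bar>b\<bar> powr p)"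
proof -
  have "\<bar>a - b\<bar> powr p \<le> (2 * max \<bar>a\<bar> \<bar>b\<bar>) powr p"
    using assms by (intro powr_mono2) auto
  also have "\<dots> = 2 powr p * max \<bar>a\<bar> \<bar>b\<bar> powr p" by (simp add: powr_mult)
  also have "\<dots> \<le> 2 powr p * (\<bar>a\<bar> powr p + \<bar>b\<bar> powr p)"
    by (intro mult_left_mono) (auto simp: max_def)
  finally show ?thesis .
qed

lemma signed_powr:
  fixes t p :: real
  shows "\<bar>t\<bar> powr (p - 2) * t = sgn t * \<bar>t\<bar> powr (p - 1)"
proof (cases "t = 0")
  case False
  have "\<bar>t\<bar> powr (p - 2) * \<bar>t\<bar> = \<bar>t\<bar> powr (p - 1)"
    using powr_add[of "\<bar>t\<bar>" "p - 2" 1] False by simp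
  then show ?thesis using False by (auto simp: sgn_if abs_if split: if_splits)
qed simp

text \<open>The integrand of the energy form for the test function \<open>\<eta>^p (\<delta> + u)^(1-p)\<close>, with \<open>a, b\<close> the values
  of \<open>u\<close> and \<open>m, n\<close> those of \<open>\<eta>\<close> at the two points. Both bounds follow from the case \<open>b \<le> a\<close>, since
  the expression is symmetric under exchanging the points.\<close>

lemma caccioppoli_pointwise:
  fixes a b m n p \<delta> :: real
  assumes p: "1 < p" and \<delta>: "0 < \<delta>" and ab: "0 \<le> a" "0 \<le> b" and mn: "0 \<le> m" "0 \<le> n"
  defines "g \<equiv> \<bar>a - b\<bar> powr (p - 2) * (a - b) * (m powr p * (\<delta> + a) powr (1 - p) - n powr p * (\<delta> + b) powr (1 - p))"
  shows "g \<le> \<bar>m - n\<bar> powr p"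
    and "m = 1 \<Longrightarrow> n = 1 \<Longrightarrow> g \<le> - ((p - 1) / 2 * \<bar>ln ((\<delta> + a) / (\<delta> + b))\<bar> powr p)"
proof -
  have g: "g = sgn (a - b) * \<bar>a - b\<bar> powr (p - 1) * (m powr p * (\<delta> + a) powr (1 - p) - n powr p * (\<delta> + b) powr (1 - p))"
    by (simp add: g_def signed_powr)
  show "g \<le> \<bar>m - n\<bar> powr p"
  proof (cases a b rule: linorder_cases)
    case less
    then show ?thesis
      using discrete_picone[OF p, of "\<delta> + a" "\<delta> + b" n m] ab mn \<delta>
      by (simp add: g abs_minus_commute algebra_simps)
  next
    case greater
    then show ?thesis
      using discrete_picone[OF p, of "\<delta> + b" "\<delta> + a" m n] ab mn \<delta>
      by (simp add: g)
  qed (simp add: g)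
  show "g \<le> - ((p - 1) / 2 * \<bar>ln ((\<delta> + a) / (\<delta> + b))\<bar> powr p)" if "m = 1" "n = 1"
  proof (cases a b rule: linorder_cases)
    case less
    have "\<bar>ln ((\<delta> + a) / (\<delta> + b))\<bar> = ln ((\<delta> + b) / (\<delta> + a))"
      using less ab \<delta> by (simp add: ln_div)
    then show ?thesis
      using log_increment_le[OF p, of "\<delta> + a" "\<delta> + b"] less ab that \<delta>
      by (simp add: g algebra_simps)
  next
    case greater
    have "\<bar>ln ((\<delta> + a) / (\<delta> + b))\<bar> = ln ((\<delta> + a) / (\<delta> + b))"
      using greater ab \<delta> by (simp add: ln_div)
    then show ?thesis
      using log_increment_le[OF p, of "\<delta> + b" "\<delta> + a"] greater ab that \<delta>
      by (simp add: g algebra_simps)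
  qed (use \<delta> ab in \<open>simp add: g\<close>)
qed

lemma powr_diff_le_unit:
  fixes m n p :: real
  assumes p: "1 < p" and "0 \<le> m" "m \<le> 1" "0 \<le> n" "n \<le> 1"
  shows "\<bar>m powr p - n powr p\<bar> \<le> p * \<bar>m - n\<bar>"
proof -
  have *: "y powr p - x powr p \<le> p * (y - x)" if xy: "0 \<le> x" "x < y" "y \<le> 1" for x y :: real
  proof (cases "x = 0")
    case True
    have "y powr p \<le> y powr 1" using xy p by (intro powr_mono') auto
    also have "\<dots> \<le> p * y" using xy p by simp
    finally show ?thesis using True by simp
  next
    case False
    have "\<exists>z>x. z < y \<and> y powr p - x powr p = (y - x) * (p * z powr (p - 1))"
      by (rule MVT2[OF xy(2)]) (use False xy in \<open>auto intro!: derivative_eq_intros\<close>)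
    then obtain z where z: "x < z" "z < y" "y powr p - x powr p = (y - x) * (p * z powr (p - 1))"
      by blast
    have "z powr (p - 1) \<le> 1" using z xy p powr_mono2[of "p - 1" z 1] by simp
    then have "p * z powr (p - 1) \<le> p" using p by simp
    then show ?thesis using z(3) xy by (simp add: mult_left_mono mult.commute[of p])
  qed
  have mono: "x powr p \<le> y powr p" if "0 \<le> x" "x \<le> y" for x y :: real
    using that p by (intro powr_mono2) auto
  show ?thesis
    using *[of m n] *[of n m] mono[of m n] mono[of n m] assms
    by (cases m n rule: linorder_cases) auto
qed

lemma negative_powr_lipschitz:
  fixes a b p \<delta> :: real
  assumes p: "1 < p" and \<delta>: "0 < \<delta>" and "\<delta> \<le> a" "\<delta> \<le> b"
  shows "\<bar>a powr (1 - p) - b powr (1 - p)\<bar> \<le> (p - 1) * \<delta> powr (- p) * \<bar>a - b\<bar>"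
proof -
  have *: "\<bar>y powr (1 - p) - x powr (1 - p)\<bar> \<le> (p - 1) * \<delta> powr (- p) * (y - x)" if xy: "\<delta> \<le> x" "x < y" for x y :: real
  proof -
    have "\<exists>z>x. z < y \<and> y powr (1 - p) - x powr (1 - p) = (y - x) * ((1 - p) * z powr (- p))"
      by (rule MVT2[OF xy(2)]) (use xy \<delta> in \<open>auto intro!: derivative_eq_intros\<close>)
    then obtain z where z: "x < z" "z < y" "y powr (1 - p) - x powr (1 - p) = (y - x) * ((1 - p) * z powr (- p))"
      by blast
    have "z powr (- p) \<le> \<delta> powr (- p)" using z xy p \<delta> by (intro powr_mono2') auto
    then have "(y - x) * ((p - 1) * z powr (- p)) \<le> (y - x) * ((p - 1) * \<delta> powr (- p))"
      using xy p by (intro mult_left_mono) auto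
    moreover have "\<bar>y powr (1 - p) - x powr (1 - p)\<bar> = (y - x) * ((p - 1) * z powr (- p))"
      unfolding z(3) using xy p by (simp add: abs_mult)
    ultimately show ?thesis by (simp add: mult_ac)
  qed
  show ?thesis
    using *[of a b] *[of b a] assms
    by (cases a b rule: linorder_cases) (auto simp: abs_minus_commute)
qed

lemma abs_ln_quotient_le:
  fixes a b \<delta> :: real
  assumes "0 < \<delta>" "\<delta> \<le> a" "\<delta> \<le> b"
  shows "\<bar>ln (a / b)\<bar> \<le> \<bar>a - b\<bar> / \<delta>"
proof -
  have *: "ln x - ln y \<le> \<bar>x - y\<bar> / \<delta>" if "\<delta> \<le> x" "\<delta> \<le> y" for x y
  proof -
    have "ln x - ln y = ln (x / y)" using that assms by (simp add: ln_div)
    also have "\<dots> \<le> x / y - 1" using that assms by (intro ln_le_minus_one) auto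
    also have "\<dots> = (x - y) / y" using that assms by (simp add: field_simps)
    also have "\<dots> \<le> \<bar>x - y\<bar> / y" using that assms by (intro divide_right_mono) auto
    also have "\<dots> \<le> \<bar>x - y\<bar> / \<delta>" using that assms by (intro divide_left_mono) auto
    finally show ?thesis .
  qed
  show ?thesis using *[of a b] *[of b a] assms
    by (simp add: ln_div abs_le_iff abs_minus_commute)
qed

section \<open>Distance and volume in dimension \<open>N\<close>\<close>

lemma space_leb: "space (leb N) = eucl N"
  by (simp add: leb_def eucl_def space_PiM)

lemma sigma_finite_leb: "sigma_finite_measure (leb N)"
proof -
  interpret product_sigma_finite "\<lambda>_::nat. lborel :: real measure" by standard
  show ?thesis unfolding leb_def by (rule sigma_finite) simp
qed

lemma pair_sigma_finite_leb: "pair_sigma_finite (leb N) (leb N)"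
  by (simp add: pair_sigma_finite_def sigma_finite_leb)

lemma leb_component_measurable:
  "i < N \<Longrightarrow> (\<lambda>x. x i) \<in> borel_measurable (leb N)"
  unfolding leb_def by measurable

lemma edist_measurable [measurable]:
  "(\<lambda>(x, y). edist N x y) \<in> borel_measurable (leb N \<Otimes>\<^sub>M leb N)"
proof -
  have [measurable]: "(\<lambda>z. fst z i) \<in> borel_measurable (leb N \<Otimes>\<^sub>M leb N)"
    "(\<lambda>z. snd z i) \<in> borel_measurable (leb N \<Otimes>\<^sub>M leb N)" if "i < N" for i
    using that leb_component_measurable[OF that] by (auto intro: measurable_compose[OF measurable_fst] measurable_compose[OF measurable_snd])
  show ?thesis unfolding edist_def L2_set_def case_prod_beta by measurable
qed

lemma edist_measurable_comp [measurable (raw)]: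
  assumes [measurable]: "f \<in> measurable M (leb N)" "g \<in> measurable M (leb N)"
  shows "(\<lambda>z. edist N (f z) (g z)) \<in> borel_measurable M"
  using measurable_compose[OF measurable_Pair[OF assms] edist_measurable] by simp

lemma edist_measurable_at: "x \<in> eucl N \<Longrightarrow> edist N x \<in> borel_measurable (leb N)"
  by (rule edist_measurable_comp) (simp_all add: space_leb)

lemma edist_nonneg [simp]: "0 \<le> edist N x y"
  by (simp add: edist_def)

lemma edist_commute: "edist N x y = edist N y x"
  unfolding edist_def by (simp add: L2_set_def power2_commute)

lemma edist_self [simp]: "edist N x x = 0"
  by (simp add: edist_def L2_set_def)

lemma edist_triangle: "edist N x z \<le> edist N x y + edist N y z"
  using L2_set_triangle_ineq[of "\<lambda>i. x i - y i" "\<lambda>i. y i - z i" "{..<N}"]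
  by (simp add: edist_def)

lemma abs_diff_edist_le: "\<bar>edist N x0 x - edist N x0 y\<bar> \<le> edist N x y"
  using edist_triangle[of N x0 x y] edist_triangle[of N x0 y x] edist_commute[of N x y] by linarith

lemma open_ball_sets [measurable]: "x \<in> eucl N \<Longrightarrow> open_ball N x \<rho> \<in> sets (leb N)"
proof -
  assume x: "x \<in> eucl N"
  note edist_measurable_at[OF x, measurable]
  have "{y \<in> space (leb N). edist N x y < \<rho>} \<in> sets (leb N)" by measurable
  then show ?thesis by (simp add: open_ball_def space_leb)
qed

text \<open>The volume of balls is available for the centre \<open>0\<close>; this moves it to any centre.\<close>

lemma leb_translation:
  assumes x: "x \<in> eucl N"
  shows "distr (leb N) (leb N) (\<lambda>y. \<lambda>i\<in>{..<N}. y i + x i) = leb N"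
proof -
  interpret product_sigma_finite "\<lambda>_::nat. lborel :: real measure" by standard
  define T where "T = (\<lambda>y. \<lambda>i\<in>{..<N}. y i + x i)"
  have T [measurable]: "T \<in> measurable (Pi\<^sub>M {..<N} (\<lambda>_. lborel)) (Pi\<^sub>M {..<N} (\<lambda>_. lborel))"
    unfolding T_def by measurable
  have "distr (Pi\<^sub>M {..<N} (\<lambda>_. lborel)) (Pi\<^sub>M {..<N} (\<lambda>_. lborel)) T = Pi\<^sub>M {..<N} (\<lambda>_. lborel)"
  proof (rule PiM_eqI)
    fix A :: "nat \<Rightarrow> real set" assume A: "\<And>i. i \<in> {..<N} \<Longrightarrow> A i \<in> sets lborel"
    have "emeasure (distr (Pi\<^sub>M {..<N} (\<lambda>_. lborel)) (Pi\<^sub>M {..<N} (\<lambda>_. lborel)) T) (Pi\<^sub>E {..<N} A)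
        = emeasure (Pi\<^sub>M {..<N} (\<lambda>_. lborel)) (T -` Pi\<^sub>E {..<N} A \<inter> space (Pi\<^sub>M {..<N} (\<lambda>_. lborel)))"
      using A by (intro emeasure_distr sets_PiM_I_finite) auto
    also have "T -` Pi\<^sub>E {..<N} A \<inter> space (Pi\<^sub>M {..<N} (\<lambda>_. lborel))
             = Pi\<^sub>E {..<N} (\<lambda>i. (\<lambda>t. x i + t) -` A i)"
      by (auto simp: T_def space_PiM PiE_iff add.commute)
    also have "emeasure (Pi\<^sub>M {..<N} (\<lambda>_. lborel)) \<dots>
             = (\<Prod>i<N. emeasure lborel ((\<lambda>t. x i + t) -` A i))"
      using A by (intro emeasure_PiM) (auto intro!: measurable_sets_borel[of _ borel])
    also have "\<dots> = (\<Prod>i<N. emeasure lborel (A i))"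
    proof (rule prod.cong[OF refl])
      fix i assume "i \<in> {..<N}"
      then have "emeasure (distr lborel borel ((+) (x i))) (A i) = emeasure lborel ((\<lambda>t. x i + t) -` A i)"
        using A by (subst emeasure_distr) auto
      then show "emeasure lborel ((\<lambda>t. x i + t) -` A i) = emeasure lborel (A i)"
        by (simp add: lborel_distr_plus)
    qed
    finally show "emeasure (distr (Pi\<^sub>M {..<N} (\<lambda>_. lborel)) (Pi\<^sub>M {..<N} (\<lambda>_. lborel)) T) (Pi\<^sub>E {..<N} A)
      = (\<Prod>i<N. emeasure lborel (A i))" .
  qed auto
  then show ?thesis by (simp add: leb_def T_def)
qed

lemma AE_leb_pair:
  assumes "AE x in leb N. P x"
  shows "AE z in leb N \<Otimes>\<^sub>M leb N. P (fst z)" "AE z in leb N \<Otimes>\<^sub>M leb N. P (snd z)"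
proof -
  interpret pair_sigma_finite "leb N" "leb N" by (rule pair_sigma_finite_leb)
  obtain Z where Z: "Z \<in> null_sets (leb N)" "{x \<in> space (leb N). \<not> P x} \<subseteq> Z"
    using assms by (auto simp: eventually_ae_filter)
  have "Z \<times> space (leb N) \<in> null_sets (leb N \<Otimes>\<^sub>M leb N)" "space (leb N) \<times> Z \<in> null_sets (leb N \<Otimes>\<^sub>M leb N)"
    using Z(1) by (auto simp: null_sets_def sigma_finite_measure.emeasure_pair_measure_Times[OF sigma_finite_leb])
  note null = this
  show "AE z in leb N \<Otimes>\<^sub>M leb N. P (fst z)"
    by (rule AE_I'[OF null(1)]) (use Z(2) in \<open>auto simp: space_pair_measure\<close>)
  show "AE z in leb N \<Otimes>\<^sub>M leb N. P (snd z)"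
    by (rule AE_I'[OF null(2)]) (use Z(2) in \<open>auto simp: space_pair_measure\<close>)
qed

section \<open>Polar coordinates\<close>

lemma sphere_area_unit_ball:
  assumes "1 \<le> N"
  shows "sphere_area N = real N * unit_ball_vol (real N)"
proof -
  have "real N / 2 \<notin> \<int>\<^sub>\<le>\<^sub>0"
    using assms by (auto dest: nonpos_Ints_nonpos)
  then have "Gamma (real N / 2 + 1) = real N / 2 * Gamma (real N / 2)"
    by (rule Gamma_plus1)
  then show ?thesis
    using assms by (simp only: sphere_area_def unit_ball_vol_def) simp
qed

lemma sphere_area_pos: "1 \<le> N \<Longrightarrow> 0 < sphere_area N"
  by (simp add: sphere_area_unit_ball)

lemma emeasure_closed_ball:
  assumes x: "x \<in> eucl N" and t: "0 < t"
  shows "emeasure (leb N) {y \<in> eucl N. edist N x y \<le> t} = ennreal (unit_ball_vol (real N) * t ^ N)"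
proof -
  define T where "T = (\<lambda>y. \<lambda>i\<in>{..<N}. y i + x i)"
  note edist_measurable_at[OF x, measurable]
  have S [measurable]: "{y \<in> eucl N. edist N x y \<le> t} \<in> sets (leb N)"
    unfolding space_leb[symmetric] by measurable
  have T [measurable]: "T \<in> measurable (leb N) (leb N)"
    unfolding T_def leb_def by measurable
  have "emeasure (leb N) {y \<in> eucl N. edist N x y \<le> t}
      = emeasure (distr (leb N) (leb N) T) {y \<in> eucl N. edist N x y \<le> t}"
    by (simp add: T_def leb_translation[OF x])
  also have "\<dots> = emeasure (leb N) (T -` {y \<in> eucl N. edist N x y \<le> t} \<inter> space (leb N))"
    by (rule emeasure_distr) measurable
  also have "T -` {y \<in> eucl N. edist N x y \<le> t} \<inter> space (leb N)
           = {f. sqrt (\<Sum>i<N. (f i)\<^sup>2) \<le> t} \<inter> space (Pi\<^sub>M {..<N} (\<lambda>_. lborel))"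
    by (auto simp: T_def space_PiM eucl_def leb_def edist_def L2_set_def)
  also have "emeasure (leb N) \<dots> = ennreal (unit_ball_vol (real N) * t ^ N)"
    unfolding leb_def using emeasure_cball_aux[of "{..<N}" t] t by simp
  finally show ?thesis .
qed

text \<open>The distribution of the distance to a fixed point. Integrals of radial functions over the
  \<open>N\<close>-dimensional space become integrals over the half-line against it.\<close>

definition radial_measure :: "nat \<Rightarrow> real measure" where
  "radial_measure N = density lborel (\<lambda>\<rho>. ennreal (indicator {0<..} \<rho> * (sphere_area N * \<rho> ^ (N - 1))))"

lemma sets_radial_measure [measurable_cong, simp]: "sets (radial_measure N) = sets borel"
  by (simp add: radial_measure_def)

lemma emeasure_radial_measure_atMost:
  assumes N: "1 \<le> N"
  shows "emeasure (radial_measure N) {..t} = ennreal (if 0 < t then unit_ball_vol (real N) * t ^ N else 0)"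
proof (cases "0 < t")
  case True
  have "emeasure (radial_measure N) {..t}
      = (\<integral>\<^sup>+\<rho>. ennreal (indicator {0<..} \<rho> * (sphere_area N * \<rho> ^ (N - 1))) * indicator {..t} \<rho> \<partial>lborel)"
    unfolding radial_measure_def by (rule emeasure_density) auto
  also have "\<dots> = (\<integral>\<^sup>+\<rho>. ennreal (sphere_area N * \<rho> ^ (N - 1)) * indicator {0..t} \<rho> \<partial>lborel)"
    by (rule nn_integral_cong_AE, rule eventually_mono[OF AE_lborel_singleton[of "0::real"]])
      (auto simp: indicator_def)
  also have "\<dots> = ennreal (unit_ball_vol (real N) * t ^ N - unit_ball_vol (real N) * 0 ^ N)"
  proof (rule nn_integral_FTC_Icc[where F = "\<lambda>\<rho>. unit_ball_vol (real N) * \<rho> ^ N"])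
    show "((\<lambda>\<rho>. unit_ball_vol (real N) * \<rho> ^ N) has_real_derivative sphere_area N * \<rho> ^ (N - 1)) (at \<rho>)" for \<rho>
      using DERIV_cmult[OF DERIV_pow[of N \<rho> UNIV], of "unit_ball_vol (real N)"]
      by (simp add: sphere_area_unit_ball[OF N] mult_ac)
    show "0 \<le> sphere_area N * \<rho> ^ (N - 1)" if "\<rho> \<in> {0..t}" for \<rho>
      using that sphere_area_pos[OF N] by simp
  qed (use True in simp_all)
  finally show ?thesis using True N by simp
next
  case False
  have "emeasure (radial_measure N) {..t}
      = (\<integral>\<^sup>+\<rho>. ennreal (indicator {0<..} \<rho> * (sphere_area N * \<rho> ^ (N - 1))) * indicator {..t} \<rho> \<partial>lborel)"
    unfolding radial_measure_def by (rule emeasure_density) auto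
  also have "\<dots> = (\<integral>\<^sup>+(\<rho>::real). 0 \<partial>lborel)"
    by (intro nn_integral_cong) (use False in \<open>auto simp: indicator_def\<close>)
  finally show ?thesis using False by simp
qed

text \<open>Polar coordinates for radial functions: the two measures agree on all half-lines \<open>{..t}\<close> by
  the formula for the volume of a ball, and these half-lines generate the Borel sets.\<close>

lemma distr_edist:
  assumes N: "1 \<le> N" and x: "x \<in> eucl N"
  shows "distr (leb N) borel (edist N x) = radial_measure N"
proof -
  note edist_measurable_at[OF x, measurable]
  have ball: "emeasure (distr (leb N) borel (edist N x)) {..t} = emeasure (leb N) {y \<in> eucl N. edist N x y \<le> t}" for t
    by (subst emeasure_distr) (auto simp: space_leb intro!: arg_cong[where f = "emeasure (leb N)"])
  have eq: "emeasure (distr (leb N) borel (edist N x)) {..t} = emeasure (radial_measure N) {..t}" for t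
  proof (cases "0 < t")
    case True
    then show ?thesis by (simp add: ball emeasure_closed_ball[OF x] emeasure_radial_measure_atMost[OF N])
  next
    case False
    \<comment> \<open>a point is a null set: it lies in balls of arbitrarily small volume\<close>
    have "emeasure (leb N) {y \<in> eucl N. edist N x y \<le> 0} \<le> ennreal e" if e: "0 < e" for e
    proof -
      define t where "t = min 1 (e / unit_ball_vol (real N))"
      have t: "0 < t" "t \<le> 1" using e by (auto simp: t_def)
      have "emeasure (leb N) {y \<in> eucl N. edist N x y \<le> 0} \<le> emeasure (leb N) {y \<in> eucl N. edist N x y \<le> t}"
        using t by (intro emeasure_mono) (auto simp: space_leb[symmetric])
      also have "\<dots> = ennreal (unit_ball_vol (real N) * t ^ N)" by (rule emeasure_closed_ball[OF x t(1)])
      also have "\<dots> \<le> ennreal (unit_ball_vol (real N) * t)"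
        using t N power_decreasing[of 1 N t] by (intro ennreal_leI mult_left_mono) auto
      also have "\<dots> \<le> ennreal e" 
      proof (rule ennreal_leI)
        have "t \<le> e / unit_ball_vol (real N)" by (simp add: t_def)
        then show "unit_ball_vol (real N) * t \<le> e"
          using unit_ball_vol_pos[of "real N"] by (simp add: pos_le_divide_eq mult.commute)
      qed
      finally show ?thesis .
    qed
    note small = this
    have "emeasure (leb N) {y \<in> eucl N. edist N x y \<le> 0} \<le> 0"
      by (rule ennreal_le_epsilon) (simp add: small)
    moreover have "emeasure (leb N) {y \<in> eucl N. edist N x y \<le> t} \<le> emeasure (leb N) {y \<in> eucl N. edist N x y \<le> 0}"
      using False by (intro emeasure_mono) (auto simp: space_leb[symmetric])
    ultimately show ?thesis using False by (simp add: ball emeasure_radial_measure_atMost[OF N])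
  qed
  have borel: "sets (borel :: real measure) = sigma_sets UNIV (range atMost)"
    by (subst borel_eq_atMost) (simp add: sets_measure_of)
  show ?thesis
  proof (rule measure_eqI_generator_eq[where E = "range atMost" and \<Omega> = UNIV and A = "\<lambda>n. {..real n}"])
    show "Int_stable (range atMost :: real set set)" by (auto simp: Int_stable_def)
    show "sets (distr (leb N) borel (edist N x)) = sigma_sets UNIV (range atMost)"
      "sets (radial_measure N) = sigma_sets UNIV (range atMost)"
      by (simp_all add: borel)
    show "(\<Union>n. {..real n}) = UNIV" using real_arch_simple by auto
    show "emeasure (distr (leb N) borel (edist N x)) {..real n} \<noteq> \<infinity>" for n
      by (simp add: eq emeasure_radial_measure_atMost[OF N])
  qed (auto simp: eq)
qed

lemma integrable_radial:
  fixes k :: "real \<Rightarrow> real"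
  assumes "1 \<le> N" "x \<in> eucl N" and k: "k \<in> borel_measurable borel"
  shows "integrable (leb N) (\<lambda>y. k (edist N x y)) \<longleftrightarrow> integrable (radial_measure N) k"
    and "(\<integral>y. k (edist N x y) \<partial>leb N) = integral\<^sup>L (radial_measure N) k"
  using assms edist_measurable_at[of x N]
  by (simp_all add: integrable_distr_eq integral_distr flip: distr_edist[of N x])

text \<open>Every double integral below is estimated by such products of a weight in one variable and a function of the distance.\<close>

lemma integral_radial_product:
  fixes k :: "real \<Rightarrow> real" and w :: "(nat \<Rightarrow> real) \<Rightarrow> real"
  assumes N: "1 \<le> N" and k: "integrable (radial_measure N) k" and w: "integrable (leb N) w"
  shows "integrable (leb N \<Otimes>\<^sub>M leb N) (\<lambda>(x, y). w x * k (edist N x y))"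
    and "integral\<^sup>L (leb N \<Otimes>\<^sub>M leb N) (\<lambda>(x, y). w x * k (edist N x y))
       = integral\<^sup>L (leb N) w * integral\<^sup>L (radial_measure N) k"
    and "integrable (leb N \<Otimes>\<^sub>M leb N) (\<lambda>(x, y). w y * k (edist N x y))"
    and "integral\<^sup>L (leb N \<Otimes>\<^sub>M leb N) (\<lambda>(x, y). w y * k (edist N x y))
       = integral\<^sup>L (leb N) w * integral\<^sup>L (radial_measure N) k"
proof -
  interpret pair_sigma_finite "leb N" "leb N" by (rule pair_sigma_finite_leb)
  have km [measurable]: "k \<in> borel_measurable borel"
    using borel_measurable_integrable[OF k] by simp
  have wm [measurable]: "w \<in> borel_measurable (leb N)" using w by auto
  define f where "f = (\<lambda>(x, y). w x * k (edist N x y))"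
  have fm [measurable]: "f \<in> borel_measurable (leb N \<Otimes>\<^sub>M leb N)" unfolding f_def by measurable
  have slice: "integrable (leb N) (\<lambda>y. f (x, y))" "(\<integral>y. f (x, y) \<partial>leb N) = w x * integral\<^sup>L (radial_measure N) k"
    "(\<integral>y. \<bar>f (x, y)\<bar> \<partial>leb N) = \<bar>w x\<bar> * integral\<^sup>L (radial_measure N) (\<lambda>\<rho>. \<bar>k \<rho>\<bar>)"
    if "x \<in> eucl N" for x
  proof -
    show "integrable (leb N) (\<lambda>y. f (x, y))" "(\<integral>y. f (x, y) \<partial>leb N) = w x * integral\<^sup>L (radial_measure N) k"
      using integrable_radial[OF N that km] k by (simp_all add: f_def)
    have "(\<integral>y. \<bar>k (edist N x y)\<bar> \<partial>leb N) = integral\<^sup>L (radial_measure N) (\<lambda>\<rho>. \<bar>k \<rho>\<bar>)"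
      by (rule integrable_radial(2)[OF N that]) simp
    then show "(\<integral>y. \<bar>f (x, y)\<bar> \<partial>leb N) = \<bar>w x\<bar> * integral\<^sup>L (radial_measure N) (\<lambda>\<rho>. \<bar>k \<rho>\<bar>)"
      by (simp add: f_def abs_mult)
  qed
  have int: "integrable (leb N \<Otimes>\<^sub>M leb N) f"
  proof (rule Fubini_integrable)
    have "integrable (leb N) (\<lambda>x. \<bar>w x\<bar> * integral\<^sup>L (radial_measure N) (\<lambda>\<rho>. \<bar>k \<rho>\<bar>))"
      using w by simp
    then show "integrable (leb N) (\<lambda>x. \<integral>y. norm (f (x, y)) \<partial>leb N)"
      by (rule Bochner_Integration.integrable_cong[THEN iffD1, rotated 2]) (simp_all add: slice space_leb)
    show "AE x in leb N. integrable (leb N) (\<lambda>y. f (x, y))"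
      by (rule AE_I2) (simp add: slice space_leb)
  qed measurable
  have "integral\<^sup>L (leb N \<Otimes>\<^sub>M leb N) f = (\<integral>x. (\<integral>y. f (x, y) \<partial>leb N) \<partial>leb N)"
    by (rule integral_fst'[OF int, symmetric])
  also have "\<dots> = (\<integral>x. w x * integral\<^sup>L (radial_measure N) k \<partial>leb N)"
    by (rule Bochner_Integration.integral_cong) (simp_all add: slice space_leb)
  finally have val: "integral\<^sup>L (leb N \<Otimes>\<^sub>M leb N) f = integral\<^sup>L (leb N) w * integral\<^sup>L (radial_measure N) k"
    by simp
  have swap: "(\<lambda>(x, y). w y * k (edist N x y)) = (\<lambda>(x, y). f (y, x))"
    by (auto simp: f_def edist_commute)
  show "integrable (leb N \<Otimes>\<^sub>M leb N) (\<lambda>(x, y). w x * k (edist N x y))"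
    "integral\<^sup>L (leb N \<Otimes>\<^sub>M leb N) (\<lambda>(x, y). w x * k (edist N x y))
       = integral\<^sup>L (leb N) w * integral\<^sup>L (radial_measure N) k"
    using int val by (simp_all add: f_def)
  show "integrable (leb N \<Otimes>\<^sub>M leb N) (\<lambda>(x, y). w y * k (edist N x y))"
    unfolding swap by (rule integrable_product_swap[OF int])
  show "integral\<^sup>L (leb N \<Otimes>\<^sub>M leb N) (\<lambda>(x, y). w y * k (edist N x y))
       = integral\<^sup>L (leb N) w * integral\<^sup>L (radial_measure N) k"
    unfolding swap integral_product_swap[OF fm] val ..
qed

section \<open>The kernel and its integrals\<close>

lemma C_const_pos:
  assumes "1 \<le> N" "0 < s" "s < 1" "1 < p"
  shows "0 < C_const N s p"
proof -
  have "0 < Gamma ((real N + s * p) / 2)" "0 < Gamma (1 - s)" "0 < Gamma ((p + 1) / 2)"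
    using assms by (auto intro!: Gamma_real_pos add_pos_pos)
  then show ?thesis using assms by (simp add: C_const_def)
qed

lemma log_kernel_measurable [measurable]: "log_kernel N s p \<in> borel_measurable borel"
  unfolding log_kernel_def by measurable

lemma log_kernel_0 [simp]: "log_kernel N s p 0 = 0"
  by (simp add: log_kernel_def)

lemma log_kernel_nonneg:
  assumes "1 \<le> N" "0 < s" "s < 1" "1 < p" "0 \<le> B_const N s p" and \<rho>: "0 \<le> \<rho>" "\<rho> \<le> 1"
  shows "0 \<le> log_kernel N s p \<rho>"
proof (cases "\<rho> = 0")
  case False
  then have "ln \<rho> \<le> 0" using \<rho> by simp
  then have "p * C_const N s p * ln \<rho> \<le> 0"
    using C_const_pos[of N s p] assms by (simp add: mult_nonneg_nonpos)
  moreover have "0 \<le> B_const N s p * C_const N s p"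
    using C_const_pos[of N s p] assms by simp
  ultimately show ?thesis by (simp add: log_kernel_def)
qed simp

text \<open>The kernel in the seminorm that defines the function space. For \<open>B \<ge> 0\<close> it is at most the full kernel
  on \<open>[0, 1]\<close>, and on every smaller interval \<open>[0, d)\<close> the full kernel is at most a multiple of it; so the seminorm
  controls the energy form at small distances.\<close>

definition singular_kernel :: "nat \<Rightarrow> real \<Rightarrow> real \<Rightarrow> real \<Rightarrow> real" where
  "singular_kernel N s p \<rho> = C_const N s p * max 0 (- ln \<rho>) / \<rho> powr (real N + s * p)"

lemma singular_kernel_measurable [measurable]: "singular_kernel N s p \<in> borel_measurable borel"
  unfolding singular_kernel_def by measurable

lemma singular_kernel_nonneg:
  "1 \<le> N \<Longrightarrow> 0 < s \<Longrightarrow> s < 1 \<Longrightarrow> 1 < p \<Longrightarrow> 0 \<le> singular_kernel N s p \<rho>"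
  using C_const_pos[of N s p] by (simp add: singular_kernel_def)

lemma log_kernel_le_singular_kernel:
  assumes "1 \<le> N" "0 < s" "s < 1" "1 < p" "0 \<le> B_const N s p" and d: "d < 1" and \<rho>: "0 \<le> \<rho>" "\<rho> < d"
  shows "log_kernel N s p \<rho> \<le> (B_const N s p / (- ln d) + p) * singular_kernel N s p \<rho>"
proof (cases "\<rho> = 0")
  case False
  then have ln: "ln \<rho> < ln d" "ln d < 0" using \<rho> d by auto
  have "B_const N s p * (- ln d) \<le> B_const N s p * (- ln \<rho>)"
    using ln assms by (intro mult_left_mono) auto
  then have "B_const N s p \<le> B_const N s p / (- ln d) * (- ln \<rho>)"
    using ln by (simp add: field_simps)
  then have "B_const N s p - p * ln \<rho> \<le> (B_const N s p / (- ln d) + p) * max 0 (- ln \<rho>)"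
    using ln by (simp add: algebra_simps max_def)
  then have "C_const N s p * (B_const N s p - p * ln \<rho>) / \<rho> powr (real N + s * p)
      \<le> C_const N s p * ((B_const N s p / (- ln d) + p) * max 0 (- ln \<rho>)) / \<rho> powr (real N + s * p)"
    using C_const_pos[of N s p] assms by (intro divide_right_mono mult_left_mono) auto
  then show ?thesis by (simp add: log_kernel_def singular_kernel_def algebra_simps)
qed (simp add: singular_kernel_def)

lemma singular_kernel_le_log_kernel:
  assumes "1 \<le> N" "0 < s" "s < 1" "1 < p" "0 \<le> B_const N s p" and \<rho>: "0 \<le> \<rho>" "\<rho> \<le> 1"
  shows "singular_kernel N s p \<rho> \<le> log_kernel N s p \<rho>"
proof (cases "\<rho> = 0")
  case False
  then have ln: "ln \<rho> \<le> 0" using \<rho> by auto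
  have "1 * (- ln \<rho>) \<le> p * (- ln \<rho>)"
    using ln assms by (intro mult_right_mono) auto
  then have "max 0 (- ln \<rho>) \<le> B_const N s p - p * ln \<rho>" using ln assms by simp
  then have "C_const N s p * max 0 (- ln \<rho>) / \<rho> powr (real N + s * p)
      \<le> C_const N s p * (B_const N s p - p * ln \<rho>) / \<rho> powr (real N + s * p)"
    using C_const_pos[of N s p] assms by (intro divide_right_mono mult_left_mono) auto
  then show ?thesis by (simp add: log_kernel_def singular_kernel_def algebra_simps)
qed (simp add: singular_kernel_def)

lemma has_bochner_integral_radial_measure:
  fixes k :: "real \<Rightarrow> real"
  assumes N: "1 \<le> N" and k [measurable]: "k \<in> borel_measurable borel"
    and "has_bochner_integral lborel (\<lambda>\<rho>. indicator {0<..} \<rho> * (sphere_area N * \<rho> ^ (N - 1)) * k \<rho>) I"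
  shows "has_bochner_integral (radial_measure N) k I"
proof -
  have nn: "AE \<rho> in lborel. 0 \<le> indicator {0<..} \<rho> * (sphere_area N * \<rho> ^ (N - 1))"
    using sphere_area_pos[OF N] by (auto simp: indicator_def)
  show ?thesis using assms(3) nn
    unfolding radial_measure_def has_bochner_integral_iff
    by (simp add: integrable_density integral_density)
qed

text \<open>The logarithm is split at \<open>a\<close> because \<open>ln (\<rho> / a)\<close> has a constant sign on either side of \<open>a\<close>, so that
  each summand can be integrated as a nonnegative function, although the kernel itself changes sign.\<close>

lemma polar_log_kernel:
  assumes "1 \<le> N" "0 < \<rho>" "0 < a"
  shows "\<rho> ^ (N - 1) * log_kernel N s p \<rho>
       = C_const N s p * ((B_const N s p - p * ln a - p * ln (\<rho> / a)) * \<rho> powr (- 1 - s * p))"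
proof -
  have "\<rho> ^ (N - 1) = \<rho> powr (real N - 1)"
    using assms by (simp add: powr_realpow of_nat_diff flip: powr_realpow)
  then have "\<rho> ^ (N - 1) / \<rho> powr (real N + s * p) = \<rho> powr (- 1 - s * p)"
    using assms by (simp flip: powr_diff)
  moreover have "\<rho> ^ (N - 1) * log_kernel N s p \<rho>
    = (C_const N s p * (B_const N s p - p * ln \<rho>)) * (\<rho> ^ (N - 1) / \<rho> powr (real N + s * p))"
  proof -
    have "B_const N s p * C_const N s p - p * C_const N s p * ln \<rho> = C_const N s p * (B_const N s p - p * ln \<rho>)"
      by (simp add: algebra_simps)
    then show ?thesis by (simp add: log_kernel_def)
  qed
  ultimately show ?thesis using assms by (simp add: ln_div algebra_simps)
qed

lemma has_bochner_integral_powr_atLeast: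
  fixes a \<sigma> :: real
  assumes a: "0 < a" and \<sigma>: "0 < \<sigma>"
  shows "has_bochner_integral lborel (\<lambda>\<rho>. indicator {a..} \<rho> * \<rho> powr (- 1 - \<sigma>)) (a powr (- \<sigma>) / \<sigma>)"
    and "has_bochner_integral lborel (\<lambda>\<rho>. indicator {a..} \<rho> * (ln (\<rho> / a) * \<rho> powr (- 1 - \<sigma>))) (a powr (- \<sigma>) / \<sigma>\<^sup>2)"
proof -
  have 0: "((\<lambda>\<rho>::real. \<rho> powr (- \<sigma>)) \<longlongrightarrow> 0) at_top"
    using \<sigma> by (intro tendsto_neg_powr filterlim_ident) auto
  have "(\<integral>\<^sup>+\<rho>. ennreal (\<rho> powr (- 1 - \<sigma>)) * indicator {a..} \<rho> \<partial>lborel) = ennreal (0 - (- (a powr (- \<sigma>)) / \<sigma>))"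
  proof (rule nn_integral_FTC_atLeast[where F = "\<lambda>\<rho>. - (\<rho> powr (- \<sigma>)) / \<sigma>"])
    show "DERIV (\<lambda>\<rho>. - (\<rho> powr (- \<sigma>)) / \<sigma>) \<rho> :> \<rho> powr (- 1 - \<sigma>)" if "a \<le> \<rho>" for \<rho>
      using that a \<sigma> by (auto intro!: derivative_eq_intros simp: field_simps minus_diff_commute)
    show "((\<lambda>\<rho>. - (\<rho> powr (- \<sigma>)) / \<sigma>) \<longlongrightarrow> 0) at_top"
      using tendsto_divide[OF tendsto_minus[OF 0] tendsto_const[of \<sigma>]] \<sigma> by simp
  qed auto
  then show "has_bochner_integral lborel (\<lambda>\<rho>. indicator {a..} \<rho> * \<rho> powr (- 1 - \<sigma>)) (a powr (- \<sigma>) / \<sigma>)"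
    using \<sigma> by (intro has_bochner_integral_nn_integral) (auto simp: mult.commute ennreal_mult'' ennreal_indicator)
  have ln0: "((\<lambda>\<rho>::real. ln (\<rho> / a) * \<rho> powr (- \<sigma>)) \<longlongrightarrow> 0) at_top"
  proof (rule tendsto_sandwich[OF _ _ tendsto_const])
    show "\<forall>\<^sub>F \<rho> in at_top. 0 \<le> ln (\<rho> / a) * \<rho> powr (- \<sigma>)"
      using eventually_ge_at_top[of a] by eventually_elim (use a in auto)
    show "\<forall>\<^sub>F \<rho> in at_top. ln (\<rho> / a) * \<rho> powr (- \<sigma>) \<le> 2 / \<sigma> * a powr (- \<sigma> / 2) * \<rho> powr (- \<sigma> / 2)"
      using eventually_ge_at_top[of a]
    proof eventually_elim
      case (elim \<rho>)
      have "ln (\<rho> / a) * \<rho> powr (- \<sigma>) \<le> (\<rho> / a) powr (\<sigma> / 2) / (\<sigma> / 2) * \<rho> powr (- \<sigma>)"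
        using elim a \<sigma> by (intro mult_right_mono ln_powr_bound) auto
      also have "\<dots> = 2 / \<sigma> * a powr (- \<sigma> / 2) * (\<rho> powr (\<sigma> / 2) * \<rho> powr (- \<sigma>))"
        using elim a by (simp add: powr_divide powr_minus field_simps)
      also have "\<rho> powr (\<sigma> / 2) * \<rho> powr (- \<sigma>) = \<rho> powr (- \<sigma> / 2)"
        by (simp flip: powr_add)
      finally show ?case .
    qed
    have "((\<lambda>\<rho>::real. \<rho> powr (- \<sigma> / 2)) \<longlongrightarrow> 0) at_top"
      using \<sigma> by (intro tendsto_neg_powr filterlim_ident) auto
    from tendsto_mult[OF tendsto_const[of "2 / \<sigma> * a powr (- \<sigma> / 2)"] this]
    show "((\<lambda>\<rho>::real. 2 / \<sigma> * a powr (- \<sigma> / 2) * \<rho> powr (- \<sigma> / 2)) \<longlongrightarrow> 0) at_top" by simp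
  qed
  have "(\<integral>\<^sup>+\<rho>. ennreal (ln (\<rho> / a) * \<rho> powr (- 1 - \<sigma>)) * indicator {a..} \<rho> \<partial>lborel)
      = ennreal (0 - (- (ln (a / a) * a powr (- \<sigma>)) / \<sigma> - a powr (- \<sigma>) / \<sigma>\<^sup>2))"
  proof (rule nn_integral_FTC_atLeast[where F = "\<lambda>\<rho>. - (ln (\<rho> / a) * \<rho> powr (- \<sigma>)) / \<sigma> - \<rho> powr (- \<sigma>) / \<sigma>\<^sup>2"])
    show "DERIV (\<lambda>\<rho>. - (ln (\<rho> / a) * \<rho> powr (- \<sigma>)) / \<sigma> - \<rho> powr (- \<sigma>) / \<sigma>\<^sup>2) \<rho> :> ln (\<rho> / a) * \<rho> powr (- 1 - \<sigma>)"
      if "a \<le> \<rho>" for \<rho>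
    proof -
      have "\<rho> powr (- \<sigma>) = \<rho> * \<rho> powr (- 1 - \<sigma>)" using that a by (simp add: powr_diff powr_minus inverse_eq_divide)
      then show ?thesis
        using that a \<sigma> by (auto intro!: derivative_eq_intros simp: field_simps power2_eq_square minus_diff_commute)
    qed
    show "((\<lambda>\<rho>. - (ln (\<rho> / a) * \<rho> powr (- \<sigma>)) / \<sigma> - \<rho> powr (- \<sigma>) / \<sigma>\<^sup>2) \<longlongrightarrow> 0) at_top"
      using tendsto_diff[OF tendsto_divide[OF tendsto_minus[OF ln0] tendsto_const[of \<sigma>]]
          tendsto_divide[OF 0 tendsto_const[of "\<sigma>\<^sup>2"]]] \<sigma> by simp
  qed (use a in auto)
  then have I: "(\<integral>\<^sup>+\<rho>. ennreal (ln (\<rho> / a) * \<rho> powr (- 1 - \<sigma>)) * indicator {a..} \<rho> \<partial>lborel) = ennreal (a powr (- \<sigma>) / \<sigma>\<^sup>2)"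
    using a by simp
  show "has_bochner_integral lborel (\<lambda>\<rho>. indicator {a..} \<rho> * (ln (\<rho> / a) * \<rho> powr (- 1 - \<sigma>))) (a powr (- \<sigma>) / \<sigma>\<^sup>2)"
  proof (rule has_bochner_integral_nn_integral)
    show "(\<integral>\<^sup>+\<rho>. ennreal (indicator {a..} \<rho> * (ln (\<rho> / a) * \<rho> powr (- 1 - \<sigma>))) \<partial>lborel) = ennreal (a powr (- \<sigma>) / \<sigma>\<^sup>2)"
      unfolding I[symmetric] by (intro nn_integral_cong) (auto simp: indicator_def)
  qed (use a in \<open>auto simp: indicator_def\<close>)
qed

text \<open>The integral must be exact here: its sign for \<open>a\<close> near \<open>e^(-1/(sp))\<close> decides about the maximum principle.\<close>

lemma log_kernel_far:
  assumes N: "1 \<le> N" and s: "0 < s" and p: "1 < p" and a: "0 < a"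
  shows "has_bochner_integral (radial_measure N) (\<lambda>\<rho>. if a \<le> \<rho> then log_kernel N s p \<rho> else 0)
     (sphere_area N * C_const N s p * a powr (- (s * p))
       * ((B_const N s p - p * ln a) / (s * p) - 1 / (s\<^sup>2 * p)))"
proof (rule has_bochner_integral_radial_measure[OF N])
  define \<sigma> where "\<sigma> = s * p"
  have \<sigma>: "0 < \<sigma>" using s p by (simp add: \<sigma>_def)
  note I = has_bochner_integral_powr_atLeast[OF a \<sigma>]
  have "has_bochner_integral lborel (\<lambda>\<rho>. sphere_area N * C_const N s p *
      ((B_const N s p - p * ln a) * (indicator {a..} \<rho> * \<rho> powr (- 1 - \<sigma>))
        - p * (indicator {a..} \<rho> * (ln (\<rho> / a) * \<rho> powr (- 1 - \<sigma>)))))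
     (sphere_area N * C_const N s p * ((B_const N s p - p * ln a) * (a powr (- \<sigma>) / \<sigma>) - p * (a powr (- \<sigma>) / \<sigma>\<^sup>2)))"
    by (intro has_bochner_integral_mult_right has_bochner_integral_diff I)
  moreover have "sphere_area N * C_const N s p * ((B_const N s p - p * ln a) * (a powr (- \<sigma>) / \<sigma>) - p * (a powr (- \<sigma>) / \<sigma>\<^sup>2))
    = sphere_area N * C_const N s p * a powr (- (s * p)) * ((B_const N s p - p * ln a) / (s * p) - 1 / (s\<^sup>2 * p))"
  proof -
    have "p * (a powr (- \<sigma>) / \<sigma>\<^sup>2) = a powr (- \<sigma>) * (1 / (s\<^sup>2 * p))"
      using p by (simp add: \<sigma>_def power2_eq_square)
    moreover have "(B_const N s p - p * ln a) * (a powr (- \<sigma>) / \<sigma>) = a powr (- \<sigma>) * ((B_const N s p - p * ln a) / \<sigma>)"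
      by simp
    ultimately show ?thesis by (simp only: right_diff_distrib[symmetric] mult.assoc \<sigma>_def)
  qed
  moreover have "sphere_area N * C_const N s p *
      ((B_const N s p - p * ln a) * (indicator {a..} \<rho> * \<rho> powr (- 1 - \<sigma>))
        - p * (indicator {a..} \<rho> * (ln (\<rho> / a) * \<rho> powr (- 1 - \<sigma>))))
     = indicator {0<..} \<rho> * (sphere_area N * \<rho> ^ (N - 1)) * (if a \<le> \<rho> then log_kernel N s p \<rho> else 0)" for \<rho>
  proof (cases "a \<le> \<rho>")
    case True
    then have "indicator {0<..} \<rho> * (sphere_area N * \<rho> ^ (N - 1)) * (if a \<le> \<rho> then log_kernel N s p \<rho> else 0)
      = sphere_area N * (\<rho> ^ (N - 1) * log_kernel N s p \<rho>)"
      using a by simp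
    also have "\<dots> = sphere_area N * (C_const N s p * ((B_const N s p - p * ln a - p * ln (\<rho> / a)) * \<rho> powr (- 1 - s * p)))"
      using True a by (subst polar_log_kernel[OF N, of \<rho> a]) auto
    finally show ?thesis using True by (simp add: \<sigma>_def algebra_simps)
  qed simp
  ultimately show "has_bochner_integral lborel (\<lambda>\<rho>. indicator {0<..} \<rho> * (sphere_area N * \<rho> ^ (N - 1)) * (if a \<le> \<rho> then log_kernel N s p \<rho> else 0))
     (sphere_area N * C_const N s p * a powr (- (s * p))
       * ((B_const N s p - p * ln a) / (s * p) - 1 / (s\<^sup>2 * p)))"
    by (simp only:)
qed measurable

lemma has_bochner_integral_powr_near_0:
  fixes r a :: real
  assumes "0 < r" "0 < a"
  shows "has_bochner_integral lborel (\<lambda>\<rho>. indicator {0..r} \<rho> * \<rho> powr (a - 1)) (r powr a / a)"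
proof (rule has_bochner_integral_nn_integral)
  have "((\<lambda>\<rho>. \<rho> powr (a - 1)) has_integral r powr a / a) {0..r}"
    using has_integral_powr_from_0[of "a - 1" r] assms by simp
  from nn_integral_has_integral_lebesgue[OF _ this]
  show "(\<integral>\<^sup>+\<rho>. ennreal (indicator {0..r} \<rho> * \<rho> powr (a - 1)) \<partial>lborel) = ennreal (r powr a / a)"
    by simp
qed (use assms in auto)

text \<open>Here an upper bound is enough, so the logarithm is replaced by a power:
  \<open>ln (r / \<rho>) \<le> (2 / \<beta>) * (r / \<rho>)^(\<beta>/2)\<close> with \<open>\<beta> = p (1 - s)\<close>, which leaves half of the exponent
  \<open>\<beta>\<close> for integrability at \<open>0\<close>. This costs the factor \<open>4\<close>.\<close>

lemma log_kernel_near: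
  assumes N: "1 \<le> N" and s: "0 < s" "s < 1" and p: "1 < p" and r: "0 < r" "r \<le> 1" and B: "0 \<le> B_const N s p"
  shows "integrable (radial_measure N) (\<lambda>\<rho>. if \<rho> < r then (\<rho> / r) powr p * log_kernel N s p \<rho> else 0)"
    and "(\<integral>\<rho>. (if \<rho> < r then (\<rho> / r) powr p * log_kernel N s p \<rho> else 0) \<partial>radial_measure N)
       \<le> sphere_area N * C_const N s p * r powr (- (s * p)) * (4 / (p * (1 - s)))
           * (B_const N s p - p * ln r + 1 / (1 - s))"
proof -
  define \<beta> X k where "\<beta> = p * (1 - s)" and "X = B_const N s p - p * ln r"
    and "k = (\<lambda>\<rho>. if \<rho> < r then (\<rho> / r) powr p * log_kernel N s p \<rho> else 0)"
  define D where "D = sphere_area N * C_const N s p * r powr (- p)"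
  have \<beta>: "0 < \<beta>" using s p by (simp add: \<beta>_def)
  have X: "0 \<le> X" using B p r by (simp add: X_def mult_nonneg_nonpos order_trans[OF _ B])
  have D: "0 \<le> D" using sphere_area_pos[OF N] C_const_pos[OF N s p] by (simp add: D_def)
  define f where "f = (\<lambda>\<rho>. indicator {0<..} \<rho> * (sphere_area N * \<rho> ^ (N - 1)) * k \<rho>)"
  define g where "g = (\<lambda>\<rho>. D * (X * (indicator {0..r} \<rho> * \<rho> powr (\<beta> - 1))
       + p * (2 / \<beta>) * r powr (\<beta> / 2) * (indicator {0..r} \<rho> * \<rho> powr (\<beta> / 2 - 1))))"
  have g: "has_bochner_integral lborel g (D * (X * (r powr \<beta> / \<beta>)
       + p * (2 / \<beta>) * r powr (\<beta> / 2) * (r powr (\<beta> / 2) / (\<beta> / 2))))"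
    unfolding g_def using r \<beta>
    by (intro has_bochner_integral_mult_right has_bochner_integral_add has_bochner_integral_powr_near_0) auto
  have fg: "0 \<le> f \<rho> \<and> f \<rho> \<le> g \<rho>" for \<rho>
  proof (cases "0 < \<rho> \<and> \<rho> < r")
    case True
    have "- ln (\<rho> / r) = ln (r / \<rho>)" using True r by (simp add: ln_div)
    also have "\<dots> \<le> (r / \<rho>) powr (\<beta> / 2) / (\<beta> / 2)"
      using True \<beta> by (intro ln_powr_bound) auto
    also have "\<dots> = 2 / \<beta> * r powr (\<beta> / 2) * \<rho> powr (- \<beta> / 2)"
      using True by (simp add: powr_divide powr_minus field_simps)
    finally have ln: "p * (- ln (\<rho> / r)) \<le> p * (2 / \<beta> * r powr (\<beta> / 2) * \<rho> powr (- \<beta> / 2))"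
      using p by (intro mult_left_mono) auto
    have f: "f \<rho> = D * ((X - p * ln (\<rho> / r)) * \<rho> powr (\<beta> - 1))"
    proof -
      have "f \<rho> = sphere_area N * (\<rho> / r) powr p * (\<rho> ^ (N - 1) * log_kernel N s p \<rho>)"
        using True by (simp add: f_def k_def)
      also have "\<dots> = sphere_area N * (\<rho> / r) powr p * (C_const N s p * ((X - p * ln (\<rho> / r)) * \<rho> powr (- 1 - s * p)))"
        using True r by (simp only: polar_log_kernel[OF N, of \<rho> r s p] X_def)
      also have "\<dots> = D * ((X - p * ln (\<rho> / r)) * (\<rho> powr p * \<rho> powr (- 1 - s * p)))"
      proof -
        have "(\<rho> / r) powr p = \<rho> powr p * r powr (- p)"
          using True r by (simp add: powr_divide powr_minus_divide)
        then show ?thesis by (simp only: D_def mult_ac)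
      qed
      also have "\<rho> powr p * \<rho> powr (- 1 - s * p) = \<rho> powr (\<beta> - 1)"
        by (simp add: \<beta>_def algebra_simps flip: powr_add)
      finally show ?thesis .
    qed
    have "0 \<le> - ln (\<rho> / r)" using True by simp
    then have "0 \<le> X - p * ln (\<rho> / r)" using X p mult_nonneg_nonpos[of p "ln (\<rho> / r)"] by linarith
    then have nn: "0 \<le> f \<rho>" unfolding f using D by simp
    have "(X - p * ln (\<rho> / r)) * \<rho> powr (\<beta> - 1)
        \<le> (X + p * (2 / \<beta> * r powr (\<beta> / 2) * \<rho> powr (- \<beta> / 2))) * \<rho> powr (\<beta> - 1)"
      using ln by (intro mult_right_mono) auto
    also have "\<dots> = X * \<rho> powr (\<beta> - 1) + p * (2 / \<beta>) * r powr (\<beta> / 2) * (\<rho> powr (- \<beta> / 2) * \<rho> powr (\<beta> - 1))"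
      by (simp add: algebra_simps)
    also have "\<rho> powr (- \<beta> / 2) * \<rho> powr (\<beta> - 1) = \<rho> powr (\<beta> / 2 - 1)"
      by (simp flip: powr_add)
    finally have "f \<rho> \<le> g \<rho>" unfolding f g_def using True D by (simp add: mult_left_mono)
    with nn show ?thesis by simp
  next
    case False
    then have "f \<rho> = 0" by (auto simp: f_def k_def)
    moreover have "0 \<le> g \<rho>" using D X p \<beta> by (simp add: g_def)
    ultimately show ?thesis by simp
  qed
  have [measurable]: "k \<in> borel_measurable borel" unfolding k_def by measurable
  have fi: "integrable lborel f"
  proof (rule Bochner_Integration.integrable_bound)
    show "integrable lborel g" using g by (rule integrable.intros)
    show "f \<in> borel_measurable lborel" unfolding f_def by measurable
    show "AE \<rho> in lborel. norm (f \<rho>) \<le> norm (g \<rho>)"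
      using fg by (auto intro!: AE_I2) (metis abs_of_nonneg order_trans)
  qed
  have k: "has_bochner_integral (radial_measure N) k (integral\<^sup>L lborel f)"
    using fi by (intro has_bochner_integral_radial_measure[OF N]) (auto simp: f_def has_bochner_integral_integrable)
  show "integrable (radial_measure N) (\<lambda>\<rho>. if \<rho> < r then (\<rho> / r) powr p * log_kernel N s p \<rho> else 0)"
    using k by (simp add: k_def has_bochner_integral_iff)
  have "integral\<^sup>L (radial_measure N) k = integral\<^sup>L lborel f"
    using k by (simp add: has_bochner_integral_iff)
  also have "\<dots> \<le> integral\<^sup>L lborel g"
    using fi g fg by (intro integral_mono) (auto simp: has_bochner_integral_iff)
  also have "\<dots> = D * r powr \<beta> * (X / \<beta> + 4 * (p / \<beta>) / \<beta>)"
    using g by (simp add: has_bochner_integral_iff powr_half_sqrt field_simps flip: powr_add)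
  also have "\<dots> \<le> D * r powr \<beta> * (4 / \<beta> * (X + p / \<beta>))"
    using D X \<beta> p by (intro mult_left_mono) (auto simp: field_simps)
  also have "D * r powr \<beta> = sphere_area N * C_const N s p * r powr (- (s * p))"
    by (simp add: D_def \<beta>_def algebra_simps flip: powr_add)
  also have "p / \<beta> = 1 / (1 - s)" using p by (simp add: \<beta>_def)
  finally show "(\<integral>\<rho>. (if \<rho> < r then (\<rho> / r) powr p * log_kernel N s p \<rho> else 0) \<partial>radial_measure N)
       \<le> sphere_area N * C_const N s p * r powr (- (s * p)) * (4 / (p * (1 - s)))
           * (B_const N s p - p * ln r + 1 / (1 - s))"
    by (simp add: k_def X_def \<beta>_def mult.assoc)
qed

section \<open>The energy form\<close>

locale kernel_parameters =
  fixes N :: nat and s p :: real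
  assumes N: "1 \<le> N" and s: "0 < s" "s < 1" and p: "1 < p" and B: "0 \<le> B_const N s p"
begin

abbreviation "K \<equiv> log_kernel N s p"
abbreviation "S \<equiv> singular_kernel N s p"
abbreviation "leb2 \<equiv> leb N \<Otimes>\<^sub>M leb N"

definition far_kernel :: "real \<Rightarrow> real \<Rightarrow> real" where
  "far_kernel a \<rho> = (if a \<le> \<rho> then K \<rho> else 0)"

definition near_kernel :: "real \<Rightarrow> real \<Rightarrow> real" where
  "near_kernel r \<rho> = (if \<rho> < r then (\<rho> / r) powr p * K \<rho> else 0)"

definition far_mass :: "real \<Rightarrow> real" where
  "far_mass a = sphere_area N * C_const N s p * a powr (- (s * p))
       * ((B_const N s p - p * ln a) / (s * p) - 1 / (s\<^sup>2 * p))"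

lemma far_kernel_integrable:
  assumes "0 < a"
  shows "integrable (radial_measure N) (far_kernel a)" "integral\<^sup>L (radial_measure N) (far_kernel a) = far_mass a"
  using log_kernel_far[OF N s(1) p assms]
  by (simp_all add: far_kernel_def[abs_def] far_mass_def has_bochner_integral_iff)

lemma K_nonneg: "0 \<le> \<rho> \<Longrightarrow> \<rho> \<le> 1 \<Longrightarrow> 0 \<le> K \<rho>"
  by (rule log_kernel_nonneg[OF N s p B])

lemma S_le_abs_K: "0 \<le> \<rho> \<Longrightarrow> S \<rho> \<le> \<bar>K \<rho>\<bar>"
proof (cases "\<rho> \<le> 1")
  case False
  then show ?thesis by (simp add: singular_kernel_def)
qed (use singular_kernel_le_log_kernel[OF N s p B] in force)

lemma W0_iff:
  "u \<in> W0 N s p \<Omega> \<longleftrightarrow> u \<in> borel_measurable (leb N) \<and> integrable (leb N) (\<lambda>x. \<bar>u x\<bar> powr p) \<and>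
     (AE x in leb N. x \<notin> \<Omega> \<longrightarrow> u x = 0) \<and>
     integrable leb2 (\<lambda>(x, y). \<bar>u x - u y\<bar> powr p * S (edist N x y))"
  by (simp add: W0_def singular_kernel_def)

text \<open>Below distance \<open>1/2\<close> the full kernel is dominated by the kernel of the seminorm; beyond, the
  kernel is integrable and the \<open>L^p\<close> norm of \<open>u\<close> suffices.\<close>

lemma W0_integrable_log_kernel:
  assumes u: "u \<in> W0 N s p \<Omega>"
  shows "integrable leb2 (\<lambda>(x, y). \<bar>u x - u y\<bar> powr p * \<bar>K (edist N x y)\<bar>)"
proof -
  have um [measurable]: "u \<in> borel_measurable (leb N)" and up: "integrable (leb N) (\<lambda>x. \<bar>u x\<bar> powr p)"
    and us: "integrable leb2 (\<lambda>(x, y). \<bar>u x - u y\<bar> powr p * S (edist N x y))"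
    using u by (auto simp: W0_iff)
  define M where "M = B_const N s p / (- ln (1 / 2)) + p"
  have M: "0 \<le> M" unfolding M_def using B p by (intro add_nonneg_nonneg divide_nonneg_nonneg) auto
  have k: "integrable (radial_measure N) (\<lambda>\<rho>. \<bar>far_kernel (1/2) \<rho>\<bar>)"
    using far_kernel_integrable(1)[of "1/2"] by simp
  have "integrable leb2 (\<lambda>z. M * (case z of (x, y) \<Rightarrow> \<bar>u x - u y\<bar> powr p * S (edist N x y))
      + 2 powr p * ((case z of (x, y) \<Rightarrow> \<bar>u x\<bar> powr p * \<bar>far_kernel (1/2) (edist N x y)\<bar>)
        + (case z of (x, y) \<Rightarrow> \<bar>u y\<bar> powr p * \<bar>far_kernel (1/2) (edist N x y)\<bar>)))"
    by (intro Bochner_Integration.integrable_add integrable_mult_right us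
        integral_radial_product(1)[OF N k up] integral_radial_product(3)[OF N k up])
  then show ?thesis
  proof (rule Bochner_Integration.integrable_bound)
    show "(\<lambda>(x, y). \<bar>u x - u y\<bar> powr p * \<bar>K (edist N x y)\<bar>) \<in> borel_measurable leb2"
      by measurable
    have "\<bar>u x - u y\<bar> powr p * \<bar>K (edist N x y)\<bar>
        \<le> M * (\<bar>u x - u y\<bar> powr p * S (edist N x y))
           + 2 powr p * (\<bar>u x\<bar> powr p * \<bar>far_kernel (1/2) (edist N x y)\<bar> + \<bar>u y\<bar> powr p * \<bar>far_kernel (1/2) (edist N x y)\<bar>)"
      (is "?l \<le> ?a + ?b") for x y
    proof (cases "edist N x y < 1/2")
      case True
      have "K (edist N x y) \<le> M * S (edist N x y)"
        unfolding M_def by (rule log_kernel_le_singular_kernel[OF N s p B]) (use True in auto)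
      moreover have "0 \<le> K (edist N x y)" using True by (intro K_nonneg) auto
      ultimately have "?l \<le> \<bar>u x - u y\<bar> powr p * (M * S (edist N x y))"
        by (intro mult_left_mono) auto
      then have "?l \<le> ?a + 0" by (simp add: mult_ac)
      also have "\<dots> \<le> ?a + ?b" by (intro add_left_mono) simp
      finally show ?thesis .
    next
      case False
      have "?l \<le> (2 powr p * (\<bar>u x\<bar> powr p + \<bar>u y\<bar> powr p)) * \<bar>K (edist N x y)\<bar>"
        by (intro mult_right_mono powr_abs_diff_le p) auto
      also have "\<dots> = ?b" using False by (simp add: far_kernel_def algebra_simps)
      finally have "?l \<le> ?b" .
      moreover have "0 \<le> ?a" using M singular_kernel_nonneg[OF N s p] by simp
      ultimately show ?thesis by simp
    qed
    then show "AE z in leb2. norm (case z of (x, y) \<Rightarrow> \<bar>u x - u y\<bar> powr p * \<bar>K (edist N x y)\<bar>)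
      \<le> norm (M * (case z of (x, y) \<Rightarrow> \<bar>u x - u y\<bar> powr p * S (edist N x y))
      + 2 powr p * ((case z of (x, y) \<Rightarrow> \<bar>u x\<bar> powr p * \<bar>far_kernel (1/2) (edist N x y)\<bar>)
        + (case z of (x, y) \<Rightarrow> \<bar>u y\<bar> powr p * \<bar>far_kernel (1/2) (edist N x y)\<bar>)))"
      by (intro AE_I2) (auto simp: abs_mult intro: order_trans[OF _ abs_ge_self])
  qed
qed

text \<open>Without this the integral in the energy form could be the default value \<open>0\<close>, and the inequality that defines
  supersolutions would carry no information.\<close>

lemma J_form_integrable:
  assumes u: "u \<in> W0 N s p \<Omega>" and \<phi>: "\<phi> \<in> W0 N s p \<Omega>"
  shows "integrable leb2 (\<lambda>(x, y). \<bar>u x - u y\<bar> powr (p - 2) * (u x - u y) * (\<phi> x - \<phi> y) * K (edist N x y))"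
proof -
  have [measurable]: "u \<in> borel_measurable (leb N)" "\<phi> \<in> borel_measurable (leb N)"
    using assms by (auto simp: W0_iff)
  have "integrable leb2 (\<lambda>z. (case z of (x, y) \<Rightarrow> \<bar>u x - u y\<bar> powr p * \<bar>K (edist N x y)\<bar>)
      + (case z of (x, y) \<Rightarrow> \<bar>\<phi> x - \<phi> y\<bar> powr p * \<bar>K (edist N x y)\<bar>))"
    by (intro Bochner_Integration.integrable_add W0_integrable_log_kernel[OF u] W0_integrable_log_kernel[OF \<phi>])
  then show ?thesis
  proof (rule Bochner_Integration.integrable_bound)
    show "(\<lambda>(x, y). \<bar>u x - u y\<bar> powr (p - 2) * (u x - u y) * (\<phi> x - \<phi> y) * K (edist N x y)) \<in> borel_measurable leb2"
      by measurable
    have "\<bar>\<bar>u x - u y\<bar> powr (p - 2) * (u x - u y) * (\<phi> x - \<phi> y) * K (edist N x y)\<bar>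
        \<le> \<bar>u x - u y\<bar> powr p * \<bar>K (edist N x y)\<bar> + \<bar>\<phi> x - \<phi> y\<bar> powr p * \<bar>K (edist N x y)\<bar>" for x y
    proof -
      have "\<bar>\<bar>u x - u y\<bar> powr (p - 2) * (u x - u y) * (\<phi> x - \<phi> y) * K (edist N x y)\<bar>
          \<le> (\<bar>u x - u y\<bar> powr (p - 1) * \<bar>\<phi> x - \<phi> y\<bar>) * \<bar>K (edist N x y)\<bar>"
        by (simp add: signed_powr abs_mult abs_sgn_eq)
      also have "\<dots> \<le> (\<bar>u x - u y\<bar> powr p + \<bar>\<phi> x - \<phi> y\<bar> powr p) * \<bar>K (edist N x y)\<bar>"
        by (intro mult_right_mono powr_young p) auto
      finally show ?thesis by (simp add: algebra_simps)
    qed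
    then show "AE z in leb2. norm (case z of (x, y) \<Rightarrow> \<bar>u x - u y\<bar> powr (p - 2) * (u x - u y) * (\<phi> x - \<phi> y) * K (edist N x y))
      \<le> norm ((case z of (x, y) \<Rightarrow> \<bar>u x - u y\<bar> powr p * \<bar>K (edist N x y)\<bar>)
      + (case z of (x, y) \<Rightarrow> \<bar>\<phi> x - \<phi> y\<bar> powr p * \<bar>K (edist N x y)\<bar>))"
      by (intro AE_I2) auto
  qed
qed

text \<open>Membership criterion used for both test functions: a function whose increments are controlled by those of \<open>u\<close>
  and of a second function with finite seminorm (a cutoff, or \<open>u\<close> again) has finite seminorm.\<close>

lemma W0_combine:
  assumes u: "u \<in> W0 N s p \<Omega>" and v: "v \<in> borel_measurable (leb N)" "integrable leb2 (\<lambda>(x, y). \<bar>v x - v y\<bar> powr p * S (edist N x y))"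
    and w: "w \<in> borel_measurable (leb N)" "integrable (leb N) (\<lambda>x. \<bar>w x\<bar> powr p)" "AE x in leb N. x \<notin> \<Omega> \<longrightarrow> w x = 0"
    and L: "0 \<le> L" "\<And>x y. \<bar>w x - w y\<bar> \<le> L * \<bar>u x - u y\<bar> + L * \<bar>v x - v y\<bar>"
  shows "w \<in> W0 N s p \<Omega>"
proof -
  note v(1) [measurable] w(1) [measurable]
  have us: "integrable leb2 (\<lambda>(x, y). \<bar>u x - u y\<bar> powr p * S (edist N x y))"
    using u by (auto simp: W0_iff)
  define A where "A = 2 powr p * L powr p"
  have A: "0 \<le> A" by (simp add: A_def)
  have "integrable leb2 (\<lambda>z. A * ((case z of (x, y) \<Rightarrow> \<bar>u x - u y\<bar> powr p * S (edist N x y))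
      + (case z of (x, y) \<Rightarrow> \<bar>v x - v y\<bar> powr p * S (edist N x y))))"
    by (intro Bochner_Integration.integrable_add integrable_mult_right us v(2))
  then have "integrable leb2 (\<lambda>(x, y). \<bar>w x - w y\<bar> powr p * S (edist N x y))"
  proof (rule Bochner_Integration.integrable_bound)
    show "(\<lambda>(x, y). \<bar>w x - w y\<bar> powr p * S (edist N x y)) \<in> borel_measurable leb2"
      by measurable
    have *: "\<bar>w x - w y\<bar> powr p \<le> A * (\<bar>u x - u y\<bar> powr p + \<bar>v x - v y\<bar> powr p)" for x y
    proof -
      have "\<bar>w x - w y\<bar> powr p \<le> \<bar>L * \<bar>u x - u y\<bar> - (- (L * \<bar>v x - v y\<bar>))\<bar> powr p"
        using L(2)[of x y] p by (intro powr_mono2) auto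
      also have "\<dots> \<le> 2 powr p * (\<bar>L * \<bar>u x - u y\<bar>\<bar> powr p + \<bar>- (L * \<bar>v x - v y\<bar>)\<bar> powr p)"
        by (rule powr_abs_diff_le[OF p])
      also have "\<dots> = A * (\<bar>u x - u y\<bar> powr p + \<bar>v x - v y\<bar> powr p)"
        using L(1) by (simp add: A_def abs_mult powr_mult algebra_simps)
      finally show ?thesis .
    qed
    have "\<bar>w x - w y\<bar> powr p * S (edist N x y)
        \<le> A * (\<bar>u x - u y\<bar> powr p * S (edist N x y) + \<bar>v x - v y\<bar> powr p * S (edist N x y))" for x y
      using mult_right_mono[OF *[of x y] singular_kernel_nonneg[OF N s p, of "edist N x y"]]
      by (simp add: algebra_simps)
    then show "AE z in leb2. norm (case z of (x, y) \<Rightarrow> \<bar>w x - w y\<bar> powr p * S (edist N x y))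
      \<le> norm (A * ((case z of (x, y) \<Rightarrow> \<bar>u x - u y\<bar> powr p * S (edist N x y))
      + (case z of (x, y) \<Rightarrow> \<bar>v x - v y\<bar> powr p * S (edist N x y))))"
      using singular_kernel_nonneg[OF N s p] A
      by (intro AE_I2) (auto simp: abs_mult intro: order_trans[OF _ abs_ge_self])
  qed
  then show ?thesis using w by (simp add: W0_iff)
qed

end

section \<open>Weak maximum principle\<close>

text \<open>The number \<open>d\<close> stands for the diameter, but lies strictly above it. Then points at distance \<open>d\<close> or
  more are never both in \<open>\<Omega>\<close>, so the double integrals can be split by the distance of the points alone.\<close>

locale supersolution_small_domain = kernel_parameters +
  fixes \<Omega> :: "(nat \<Rightarrow> real) set" and u :: "(nat \<Rightarrow> real) \<Rightarrow> real" and d :: real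
  assumes super: "supersolution N s p \<Omega> u"
    and d: "0 < d" "d < exp (- 1 / (s * p))"
    and diam: "\<And>x y. x \<in> \<Omega> \<Longrightarrow> y \<in> \<Omega> \<Longrightarrow> edist N x y < d"
begin

lemma u_W0: "u \<in> W0 N s p \<Omega>"
  using super by (simp add: supersolution_def)

lemma u_measurable [measurable]: "u \<in> borel_measurable (leb N)"
  using u_W0 by (simp add: W0_iff)

lemma d_less_1: "d < 1"
proof -
  have "d < exp (- 1 / (s * p))" by (rule d(2))
  also have "exp (- 1 / (s * p)) < 1" using s p by simp
  finally show ?thesis .
qed

lemma minus_ln_d: "1 / s < - (p * ln d)"
proof -
  have "ln d < - 1 / (s * p)" using d by (metis exp_less_cancel_iff exp_ln)
  then have "p * ln d < p * (- 1 / (s * p))" using p by (intro mult_strict_left_mono) auto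
  then show ?thesis using p s by simp
qed

lemma far_mass_pos: "0 < far_mass d"
proof -
  have "(B_const N s p - p * ln d) / (s * p) - 1 / (s\<^sup>2 * p) = (B_const N s p - p * ln d - 1 / s) / (s * p)"
    using s p by (simp add: field_simps power2_eq_square)
  moreover have "0 < B_const N s p - p * ln d - 1 / s" using B minus_ln_d by simp
  ultimately show ?thesis
    using sphere_area_pos[OF N] C_const_pos[OF N s p] s p d by (simp add: far_mass_def)
qed

lemma vanishing_outside:
  "AE z in leb2. (fst z \<notin> \<Omega> \<longrightarrow> u (fst z) = 0) \<and> (snd z \<notin> \<Omega> \<longrightarrow> u (snd z) = 0)"
proof -
  have "AE x in leb N. x \<notin> \<Omega> \<longrightarrow> u x = 0" using u_W0 by (simp add: W0_iff)
  from AE_leb_pair[OF this] show ?thesis by eventually_elim auto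
qed

text \<open>Weak maximum principle. Test with the negative part \<open>v\<close> of \<open>u\<close>. At distance below \<open>d\<close> the integrand is
  nonpositive by monotonicity. At distance \<open>d\<close> or more one of the two values of \<open>u\<close> is \<open>0\<close> and the
  integrand equals \<open>-(v(x)^p + v(y)^p) K\<close>, whose integral is \<open>-2 * far_mass d\<close> times that of \<open>v^p\<close>.
  Since \<open>far_mass d > 0\<close>, the function \<open>v\<close> vanishes.\<close>

theorem supersolution_nonneg: "AE x in leb N. 0 \<le> u x"
proof -
  define v where "v = (\<lambda>x. max 0 (- u x))"
  define g where "g = (\<lambda>(x, y). \<bar>u x - u y\<bar> powr (p - 2) * (u x - u y) * (v x - v y) * K (edist N x y))"
  have up: "integrable (leb N) (\<lambda>x. \<bar>u x\<bar> powr p)" using u_W0 by (simp add: W0_iff)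
  have [measurable]: "v \<in> borel_measurable (leb N)" unfolding v_def by measurable
  have vp: "integrable (leb N) (\<lambda>x. \<bar>v x\<bar> powr p)"
    by (rule Bochner_Integration.integrable_bound[OF up]) (use p in \<open>auto simp: v_def intro!: powr_mono2\<close>)
  have vW: "v \<in> W0 N s p \<Omega>"
  proof (rule W0_combine[OF u_W0, of u v 1])
    show "AE x in leb N. x \<notin> \<Omega> \<longrightarrow> v x = 0" using u_W0 by (auto simp: W0_iff v_def elim: eventually_mono)
    show "\<bar>v x - v y\<bar> \<le> 1 * \<bar>u x - u y\<bar> + 1 * \<bar>u x - u y\<bar>" for x y
      by (auto simp: v_def max_def abs_if)
  qed (use u_W0 vp in \<open>auto simp: W0_iff v_def\<close>)
  have "0 \<le> J_form N s p u v"
    using super vW by (auto simp: supersolution_def v_def)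
  then have J: "0 \<le> integral\<^sup>L leb2 g" by (simp add: J_form_def g_def)
  have gi: "integrable leb2 g" unfolding g_def by (rule J_form_integrable[OF u_W0 vW])
  have fk: "integrable (radial_measure N) (far_kernel d)" using far_kernel_integrable d by simp
  note P = integral_radial_product[OF N fk vp]
  have "integral\<^sup>L leb2 g \<le> integral\<^sup>L leb2 (\<lambda>z. - ((case z of (x, y) \<Rightarrow> \<bar>v x\<bar> powr p * far_kernel d (edist N x y))
       + (case z of (x, y) \<Rightarrow> \<bar>v y\<bar> powr p * far_kernel d (edist N x y))))"
  proof (rule integral_mono_AE[OF gi])
    show "integrable leb2 (\<lambda>z. - ((case z of (x, y) \<Rightarrow> \<bar>v x\<bar> powr p * far_kernel d (edist N x y))
       + (case z of (x, y) \<Rightarrow> \<bar>v y\<bar> powr p * far_kernel d (edist N x y))))"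
      by (intro Bochner_Integration.integrable_minus Bochner_Integration.integrable_add P)
    have neg: "\<bar>t\<bar> powr (p - 2) * t * max 0 (- t) = - (\<bar>max 0 (- t)\<bar> powr p)" for t :: real
    proof (cases "t < 0")
      case True
      have "\<bar>t\<bar> powr (p - 1) * \<bar>t\<bar> = \<bar>t\<bar> powr p" using True powr_add[of "\<bar>t\<bar>" "p - 1" 1] by simp
      then show ?thesis unfolding signed_powr using True by simp
    qed simp
    show "AE z in leb2. g z \<le> - ((case z of (x, y) \<Rightarrow> \<bar>v x\<bar> powr p * far_kernel d (edist N x y))
       + (case z of (x, y) \<Rightarrow> \<bar>v y\<bar> powr p * far_kernel d (edist N x y)))"
      using vanishing_outside
    proof eventually_elim
      case (elim z)
      obtain x y where z: "z = (x, y)" by (cases z)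
      show ?case
      proof (cases "edist N x y < d")
        case True
        have "(u x - u y) * (v x - v y) \<le> 0"
          by (auto simp: v_def max_def mult_le_0_iff)
        moreover have "0 \<le> K (edist N x y)" using True d_less_1 by (intro K_nonneg) auto
        ultimately have "\<bar>u x - u y\<bar> powr (p - 2) * ((u x - u y) * (v x - v y)) * K (edist N x y) \<le> 0"
          by (intro mult_nonpos_nonneg[OF mult_nonneg_nonpos[OF powr_ge_zero]])
        then show ?thesis using True by (simp add: z g_def far_kernel_def mult.assoc)
      next
        case False
        then have "x \<notin> \<Omega> \<or> y \<notin> \<Omega>" using diam by blast
        then have "u x = 0 \<or> u y = 0" using elim by (auto simp: z)
        then show ?thesis
        proof
          assume "u y = 0"
          then show ?thesis using False neg[of "u x"] p by (simp add: z g_def far_kernel_def v_def)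
        next
          assume "u x = 0"
          then show ?thesis using False neg[of "u y"] p by (simp add: z g_def far_kernel_def v_def)
        qed
      qed
    qed
  qed
  also have "\<dots> = - 2 * far_mass d * (\<integral>x. \<bar>v x\<bar> powr p \<partial>leb N)"
    by (simp only: Bochner_Integration.integral_minus Bochner_Integration.integral_add[OF P(1,3)] P(2,4)
        far_kernel_integrable(2)[OF d(1)], simp)
  finally have "(\<integral>x. \<bar>v x\<bar> powr p \<partial>leb N) \<le> 0"
    using J far_mass_pos by (smt (verit) mult_neg_pos)
  moreover have "0 \<le> (\<integral>x. \<bar>v x\<bar> powr p \<partial>leb N)" by simp
  ultimately have "AE x in leb N. \<bar>v x\<bar> powr p = 0"
    using integral_nonneg_eq_0_iff_AE[OF vp] by simp
  then show ?thesis by eventually_elim (auto simp: v_def max_def split: if_splits)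
qed

end

section \<open>The logarithmic test function\<close>

locale log_estimate = supersolution_small_domain +
  fixes x0 :: "nat \<Rightarrow> real" and r \<delta> :: real
  assumes x0: "x0 \<in> eucl N" and r: "0 < r" "r \<le> d" and \<delta>: "0 < \<delta>"
    and ball: "open_ball N x0 (3 * r) \<subseteq> \<Omega>"
begin

abbreviation "b2 \<equiv> open_ball N x0 (2 * r)"
abbreviation "b3 \<equiv> open_ball N x0 (3 * r)"

lemma balls_measurable [measurable]: "b2 \<in> sets (leb N)" "b3 \<in> sets (leb N)"
  using x0 by (simp_all add: open_ball_sets)

lemma b2_subset: "b2 \<subseteq> b3"
  using r by (auto simp: open_ball_def)

lemma b3_volume:
  shows "integrable (leb N) (indicator b3 :: _ \<Rightarrow> real)"
    and "measure (leb N) b3 \<le> unit_ball_vol (real N) * (3 * r) ^ N"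
proof -
  note edist_measurable_at[OF x0, measurable]
  have "emeasure (leb N) b3 \<le> emeasure (leb N) {y \<in> eucl N. edist N x0 y \<le> 3 * r}"
    by (intro emeasure_mono) (auto simp: open_ball_def space_leb[symmetric])
  also have "\<dots> = ennreal (unit_ball_vol (real N) * (3 * r) ^ N)"
    using r by (intro emeasure_closed_ball x0) auto
  finally have le: "emeasure (leb N) b3 \<le> ennreal (unit_ball_vol (real N) * (3 * r) ^ N)" .
  then have fin: "emeasure (leb N) b3 < \<infinity>" by (simp add: le_less_trans)
  then show "integrable (leb N) (indicator b3 :: _ \<Rightarrow> real)" by (intro integrable_real_indicator) auto
  have "0 \<le> unit_ball_vol (real N) * (3 * r) ^ N" using r by simp
  then show "measure (leb N) b3 \<le> unit_ball_vol (real N) * (3 * r) ^ N"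
    using le by (simp add: measure_def enn2real_leI)
qed

definition cutoff :: "(nat \<Rightarrow> real) \<Rightarrow> real" where
  "cutoff x = max 0 (min 1 (3 - edist N x0 x / r))"

lemma cutoff_measurable [measurable]: "cutoff \<in> borel_measurable (leb N)"
proof -
  note edist_measurable_at[OF x0, measurable]
  show ?thesis unfolding cutoff_def[abs_def] by measurable
qed

lemma cutoff_range: "0 \<le> cutoff x" "cutoff x \<le> 1"
  by (auto simp: cutoff_def)

lemma cutoff_eq_1: "x \<in> b2 \<Longrightarrow> cutoff x = 1"
  using r by (auto simp: cutoff_def open_ball_def field_simps)

lemma cutoff_eq_0: "x \<in> eucl N \<Longrightarrow> x \<notin> b3 \<Longrightarrow> cutoff x = 0"
  using r by (auto simp: cutoff_def open_ball_def field_simps)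

lemma cutoff_diff: "\<bar>cutoff x - cutoff y\<bar> \<le> 1" "\<bar>cutoff x - cutoff y\<bar> \<le> edist N x y / r"
proof -
  show "\<bar>cutoff x - cutoff y\<bar> \<le> 1" using cutoff_range[of x] cutoff_range[of y] by linarith
  have "\<bar>cutoff x - cutoff y\<bar> \<le> \<bar>(3 - edist N x0 x / r) - (3 - edist N x0 y / r)\<bar>"
    unfolding cutoff_def by (auto simp: max_def min_def)
  also have "\<dots> = \<bar>edist N x0 x - edist N x0 y\<bar> / r"
    using r by (simp add: abs_minus_commute flip: diff_divide_distrib)
  also have "\<dots> \<le> edist N x y / r"
    using r abs_diff_edist_le by (intro divide_right_mono) auto
  finally show "\<bar>cutoff x - cutoff y\<bar> \<le> edist N x y / r" .
qed

text \<open>Bounds \<open>|\<eta>(x) - \<eta>(y)|^p K\<close> at distance below \<open>d\<close>; it vanishes from \<open>d\<close> on.\<close>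

definition mid_kernel :: "real \<Rightarrow> real" where
  "mid_kernel \<rho> = near_kernel r \<rho> + far_kernel r \<rho> - far_kernel d \<rho>"

lemma near_kernel_integrable: "integrable (radial_measure N) (near_kernel r)"
  using log_kernel_near(1)[OF N s p r(1) _ B] r d_less_1 by (simp add: near_kernel_def[abs_def])

lemma mid_kernel_integral:
  "integrable (radial_measure N) mid_kernel"
  "integral\<^sup>L (radial_measure N) mid_kernel = integral\<^sup>L (radial_measure N) (near_kernel r) + far_mass r - far_mass d"
  using near_kernel_integrable far_kernel_integrable[OF r(1)] far_kernel_integrable[OF d(1)]
  by (simp_all add: mid_kernel_def[abs_def])

lemma cutoff_diff_powr_le:
  assumes "edist N x y < d"
  shows "\<bar>cutoff x - cutoff y\<bar> powr p * K (edist N x y) \<le> mid_kernel (edist N x y)"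
    and "0 \<le> mid_kernel (edist N x y)"
proof -
  have K: "0 \<le> K (edist N x y)" using assms d_less_1 by (intro K_nonneg) auto
  have "\<bar>cutoff x - cutoff y\<bar> powr p \<le> (edist N x y / r) powr p"
    "\<bar>cutoff x - cutoff y\<bar> powr p \<le> 1 powr p"
    using cutoff_diff[of x y] p by (intro powr_mono2; auto)+
  then show "\<bar>cutoff x - cutoff y\<bar> powr p * K (edist N x y) \<le> mid_kernel (edist N x y)"
    using assms K by (auto simp: mid_kernel_def near_kernel_def far_kernel_def intro: mult_right_mono
      mult_left_le_one_le)
  show "0 \<le> mid_kernel (edist N x y)"
    using assms K by (auto simp: mid_kernel_def near_kernel_def far_kernel_def)
qed

lemma cutoff_seminorm: "integrable leb2 (\<lambda>(x, y). \<bar>cutoff x - cutoff y\<bar> powr p * S (edist N x y))"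
proof -
  define k where "k = (\<lambda>\<rho>. \<bar>near_kernel r \<rho>\<bar> + \<bar>far_kernel r \<rho>\<bar>)"
  have k: "integrable (radial_measure N) k"
    using near_kernel_integrable far_kernel_integrable(1)[OF r(1)] by (simp add: k_def)
  have "integrable leb2 (\<lambda>z. (case z of (x, y) \<Rightarrow> indicator b3 x * k (edist N x y))
      + (case z of (x, y) \<Rightarrow> indicator b3 y * k (edist N x y)))"
    by (intro Bochner_Integration.integrable_add integral_radial_product(1)[OF N k b3_volume(1)]
        integral_radial_product(3)[OF N k b3_volume(1)])
  then show ?thesis
  proof (rule Bochner_Integration.integrable_bound)
    show "(\<lambda>(x, y). \<bar>cutoff x - cutoff y\<bar> powr p * S (edist N x y)) \<in> borel_measurable leb2"
      by measurable
    have "\<bar>cutoff x - cutoff y\<bar> powr p * S (edist N x y)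
        \<le> indicator b3 x * k (edist N x y) + indicator b3 y * k (edist N x y)" (is "?l \<le> ?r")
      if "x \<in> eucl N" "y \<in> eucl N" for x y
    proof (cases "x \<in> b3 \<or> y \<in> b3")
      case True
      have k0: "0 \<le> k \<rho>" for \<rho> by (simp add: k_def)
      have "\<bar>cutoff x - cutoff y\<bar> powr p \<le> (edist N x y / r) powr p"
        "\<bar>cutoff x - cutoff y\<bar> powr p \<le> 1 powr p"
        using cutoff_diff[of x y] p by (intro powr_mono2; auto)+
      then have "\<bar>cutoff x - cutoff y\<bar> powr p * \<bar>K (edist N x y)\<bar> \<le> k (edist N x y)"
        by (auto simp: k_def near_kernel_def far_kernel_def abs_mult intro: mult_right_mono mult_left_le_one_le)
      moreover have "?l \<le> \<bar>cutoff x - cutoff y\<bar> powr p * \<bar>K (edist N x y)\<bar>"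
        by (intro mult_left_mono S_le_abs_K) auto
      moreover have "k (edist N x y) \<le> ?r"
        using True k0[of "edist N x y"] by (auto simp: indicator_def)
      ultimately show ?thesis by linarith
    qed (use that in \<open>simp add: cutoff_eq_0\<close>)
    then show "AE z in leb2. norm (case z of (x, y) \<Rightarrow> \<bar>cutoff x - cutoff y\<bar> powr p * S (edist N x y))
      \<le> norm ((case z of (x, y) \<Rightarrow> indicator b3 x * k (edist N x y))
      + (case z of (x, y) \<Rightarrow> indicator b3 y * k (edist N x y)))"
      using singular_kernel_nonneg[OF N s p]
      by (intro AE_I2) (auto simp: space_pair_measure space_leb abs_mult intro: order_trans[OF _ abs_ge_self])
  qed
qed

text \<open>The positive part makes the formula meaningful at every point; it agrees with \<open>u\<close> almost everywhere.\<close>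

definition test :: "(nat \<Rightarrow> real) \<Rightarrow> real" where
  "test x = cutoff x powr p * (\<delta> + max 0 (u x)) powr (1 - p)"

text \<open>The shift by \<open>\<delta>\<close> keeps the negative power away from its singularity.\<close>

lemma test_lipschitz:
  "\<bar>test x - test y\<bar> \<le> (p * \<delta> powr (1 - p) + (p - 1) * \<delta> powr (- p)) * \<bar>u x - u y\<bar>
     + (p * \<delta> powr (1 - p) + (p - 1) * \<delta> powr (- p)) * \<bar>cutoff x - cutoff y\<bar>"
proof -
  define A where "A = (\<lambda>x. (\<delta> + max 0 (u x)) powr (1 - p))"
  have A: "0 \<le> A x" "A x \<le> \<delta> powr (1 - p)" for x
    using \<delta> p by (auto simp: A_def intro!: powr_mono2')
  have c: "cutoff y powr p \<le> 1" using cutoff_range[of y] p powr_mono2[of p "cutoff y" 1] by simp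
  have "test x - test y = (cutoff x powr p - cutoff y powr p) * A x + cutoff y powr p * (A x - A y)"
    by (simp add: test_def A_def algebra_simps)
  then have "\<bar>test x - test y\<bar> \<le> \<bar>cutoff x powr p - cutoff y powr p\<bar> * A x + cutoff y powr p * \<bar>A x - A y\<bar>"
    using abs_triangle_ineq[of "(cutoff x powr p - cutoff y powr p) * A x" "cutoff y powr p * (A x - A y)"] A(1)[of x]
    by (simp add: abs_mult)
  also have "\<dots> \<le> (p * \<bar>cutoff x - cutoff y\<bar>) * \<delta> powr (1 - p) + 1 * ((p - 1) * \<delta> powr (- p) * \<bar>u x - u y\<bar>)"
  proof (intro add_mono mult_mono)
    show "\<bar>cutoff x powr p - cutoff y powr p\<bar> \<le> p * \<bar>cutoff x - cutoff y\<bar>"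
      by (intro powr_diff_le_unit p cutoff_range)
    have "\<bar>A x - A y\<bar> \<le> (p - 1) * \<delta> powr (- p) * \<bar>(\<delta> + max 0 (u x)) - (\<delta> + max 0 (u y))\<bar>"
      unfolding A_def by (rule negative_powr_lipschitz[OF p \<delta>]) auto
    also have "\<dots> \<le> (p - 1) * \<delta> powr (- p) * \<bar>u x - u y\<bar>"
      using p by (intro mult_left_mono) (auto simp: max_def)
    finally show "\<bar>A x - A y\<bar> \<le> (p - 1) * \<delta> powr (- p) * \<bar>u x - u y\<bar>" .
  qed (use p A c in auto)
  also have "\<dots> = p * \<delta> powr (1 - p) * \<bar>cutoff x - cutoff y\<bar> + (p - 1) * \<delta> powr (- p) * \<bar>u x - u y\<bar>"
    by simp
  finally have "\<bar>test x - test y\<bar>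
      \<le> p * \<delta> powr (1 - p) * \<bar>cutoff x - cutoff y\<bar> + (p - 1) * \<delta> powr (- p) * \<bar>u x - u y\<bar>" .
  moreover have "0 \<le> p * \<delta> powr (1 - p) * \<bar>u x - u y\<bar>" "0 \<le> (p - 1) * \<delta> powr (- p) * \<bar>cutoff x - cutoff y\<bar>"
    using p by simp_all
  ultimately show ?thesis unfolding distrib_right by linarith
qed

lemma test_W0: "test \<in> W0 N s p \<Omega>"
proof (rule W0_combine[OF u_W0 cutoff_measurable cutoff_seminorm _ _ _ _ test_lipschitz])
  show [measurable]: "test \<in> borel_measurable (leb N)" unfolding test_def[abs_def] by measurable
  have "integrable (leb N) (\<lambda>x. (\<delta> powr (1 - p)) powr p * indicator b3 x)"
    using b3_volume(1) by simp
  then show "integrable (leb N) (\<lambda>x. \<bar>test x\<bar> powr p)"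
  proof (rule Bochner_Integration.integrable_bound)
    have "\<bar>test x\<bar> powr p \<le> (\<delta> powr (1 - p)) powr p * indicator b3 x" if "x \<in> eucl N" for x
    proof (cases "x \<in> b3")
      case True
      have "cutoff x powr p \<le> 1" using cutoff_range[of x] p powr_mono2[of p "cutoff x" 1] by simp
      moreover have "(\<delta> + max 0 (u x)) powr (1 - p) \<le> \<delta> powr (1 - p)" using \<delta> p by (intro powr_mono2') auto
      ultimately have "\<bar>test x\<bar> \<le> 1 * \<delta> powr (1 - p)" unfolding test_def abs_mult by (intro mult_mono) auto
      then have "\<bar>test x\<bar> powr p \<le> (\<delta> powr (1 - p)) powr p" using p by (intro powr_mono2) auto
      then show ?thesis using True by simp
    qed (use that in \<open>simp add: test_def cutoff_eq_0\<close>)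
    then show "AE x in leb N. norm (\<bar>test x\<bar> powr p) \<le> norm ((\<delta> powr (1 - p)) powr p * indicator b3 x)"
      by (intro AE_I2) (auto simp: space_leb abs_mult)
  qed measurable
  show "AE x in leb N. x \<notin> \<Omega> \<longrightarrow> test x = 0"
    using ball by (intro AE_I2) (auto simp: space_leb test_def intro!: cutoff_eq_0)
  show "0 \<le> p * \<delta> powr (1 - p) + (p - 1) * \<delta> powr (- p)" using p by simp
qed

definition log_oscillation :: "(nat \<Rightarrow> real) \<times> (nat \<Rightarrow> real) \<Rightarrow> real" where
  "log_oscillation = (\<lambda>(x, y). indicator (b2 \<times> b2) (x, y) * (K (edist N x y) * \<bar>ln ((\<delta> + u x) / (\<delta> + u y))\<bar> powr p))"

lemma nonneg_pairs: "AE z in leb2. 0 \<le> u (fst z) \<and> 0 \<le> u (snd z)"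
  using AE_leb_pair[OF supersolution_nonneg] by eventually_elim auto

lemma log_oscillation_integrable: "integrable leb2 log_oscillation"
proof -
  have "integrable leb2 (\<lambda>z. (1 / \<delta>) powr p * (case z of (x, y) \<Rightarrow> \<bar>u x - u y\<bar> powr p * \<bar>K (edist N x y)\<bar>))"
    by (intro integrable_mult_right W0_integrable_log_kernel[OF u_W0])
  then show ?thesis
  proof (rule Bochner_Integration.integrable_bound)
    have "b2 \<times> b2 \<in> sets leb2" by measurable
    then show "log_oscillation \<in> borel_measurable leb2" unfolding log_oscillation_def by measurable
    show "AE z in leb2. norm (log_oscillation z)
      \<le> norm ((1 / \<delta>) powr p * (case z of (x, y) \<Rightarrow> \<bar>u x - u y\<bar> powr p * \<bar>K (edist N x y)\<bar>))"
      using nonneg_pairs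
    proof eventually_elim
      case (elim z)
      obtain x y where z: "z = (x, y)" by (cases z)
      have "\<bar>ln ((\<delta> + u x) / (\<delta> + u y))\<bar> \<le> \<bar>(\<delta> + u x) - (\<delta> + u y)\<bar> / \<delta>"
        using elim \<delta> by (intro abs_ln_quotient_le) (auto simp: z)
      then have "\<bar>ln ((\<delta> + u x) / (\<delta> + u y))\<bar> powr p \<le> (1 / \<delta> * \<bar>u x - u y\<bar>) powr p"
        using p by (intro powr_mono2) auto
      also have "\<dots> = (1 / \<delta>) powr p * \<bar>u x - u y\<bar> powr p" by (rule powr_mult)
      finally have "\<bar>K (edist N x y)\<bar> * \<bar>ln ((\<delta> + u x) / (\<delta> + u y))\<bar> powr p
          \<le> \<bar>K (edist N x y)\<bar> * ((1 / \<delta>) powr p * \<bar>u x - u y\<bar> powr p)"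
        by (intro mult_left_mono) auto
      then show ?case by (auto simp: z log_oscillation_def indicator_def abs_mult mult_ac)
    qed
  qed
qed

text \<open>The value of the energy integrand, without the kernel, at a pair whose second point lies outside \<open>\<Omega>\<close>. Since it lies in \<open>[0, 1]\<close>
  and does not depend on the second point, the sign-changing far part of the kernel can be integrated
  against it exactly.\<close>

definition damping :: "(nat \<Rightarrow> real) \<Rightarrow> real" where
  "damping x = indicator b3 x * (cutoff x powr p * (max 0 (u x) / (\<delta> + max 0 (u x))) powr (p - 1))"

lemma damping_bounds: "0 \<le> damping x" "damping x \<le> indicator b3 x"
proof -
  show "0 \<le> damping x" by (simp add: damping_def)
  have "cutoff x powr p \<le> 1" using cutoff_range[of x] p powr_mono2[of p "cutoff x" 1] by simp
  moreover have "(max 0 (u x) / (\<delta> + max 0 (u x))) powr (p - 1) \<le> 1"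
    using p \<delta> powr_mono2[of "p - 1" "max 0 (u x) / (\<delta> + max 0 (u x))" 1] by (simp add: field_simps)
  ultimately have "cutoff x powr p * (max 0 (u x) / (\<delta> + max 0 (u x))) powr (p - 1) \<le> 1 * 1"
    by (intro mult_mono) auto
  then show "damping x \<le> indicator b3 x" by (simp add: damping_def indicator_def)
qed

lemma damping_integrable: "integrable (leb N) damping"
  by (rule Bochner_Integration.integrable_bound[OF b3_volume(1)])
    (use damping_bounds in \<open>auto simp: damping_def[abs_def]\<close>)

text \<open>At distance below \<open>d\<close> the kernel is nonnegative and the discrete Picone inequality applies; at distance \<open>d\<close> or more the
  kernel has no sign, but one point lies outside \<open>\<Omega>\<close> and the inequality is an equality.\<close>

lemma energy_pointwise:
  assumes x: "x \<in> eucl N" "0 \<le> u x" "x \<notin> \<Omega> \<longrightarrow> u x = 0"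
    and y: "y \<in> eucl N" "0 \<le> u y" "y \<notin> \<Omega> \<longrightarrow> u y = 0"
  shows "\<bar>u x - u y\<bar> powr (p - 2) * (u x - u y) * (test x - test y) * K (edist N x y)
    \<le> (indicator b3 x * mid_kernel (edist N x y) + indicator b3 y * mid_kernel (edist N x y))
      + (damping x * far_kernel d (edist N x y) + damping y * far_kernel d (edist N x y))
      - (p - 1) / 2 * log_oscillation (x, y)"
    (is "?g * K ?\<rho> \<le> _")
proof (cases "?\<rho> < d")
  case True
  have K: "0 \<le> K ?\<rho>" using True d_less_1 by (intro K_nonneg) auto
  have g: "?g = \<bar>u x - u y\<bar> powr (p - 2) * (u x - u y) * (cutoff x powr p * (\<delta> + u x) powr (1 - p) - cutoff y powr p * (\<delta> + u y) powr (1 - p))"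
    using x y by (simp add: test_def)
  note C = caccioppoli_pointwise[OF p \<delta> x(2) y(2) cutoff_range(1)[of x] cutoff_range(1)[of y], folded g]
  note mid = cutoff_diff_powr_le[OF True]
  have far: "far_kernel d ?\<rho> = 0" using True by (simp add: far_kernel_def)
  show ?thesis
  proof (cases "x \<in> b2 \<and> y \<in> b2")
    case b2: True
    then have "?g * K ?\<rho> \<le> - ((p - 1) / 2 * \<bar>ln ((\<delta> + u x) / (\<delta> + u y))\<bar> powr p) * K ?\<rho>"
      using K C(2) by (intro mult_right_mono) (auto simp: cutoff_eq_1)
    also have "\<dots> = - ((p - 1) / 2 * log_oscillation (x, y))"
      using b2 by (simp add: log_oscillation_def)
    finally show ?thesis using far mid(2) by (simp add: indicator_def)
  next
    case False
    then have osc: "log_oscillation (x, y) = 0" by (auto simp: log_oscillation_def indicator_def)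
    have "?g * K ?\<rho> \<le> \<bar>cutoff x - cutoff y\<bar> powr p * K ?\<rho>"
      using K C(1) by (intro mult_right_mono) auto
    also have "\<dots> \<le> indicator b3 x * mid_kernel ?\<rho> + indicator b3 y * mid_kernel ?\<rho>"
    proof (cases "x \<in> b3 \<or> y \<in> b3")
      case True
      then show ?thesis using mid by (auto simp: indicator_def)
    qed (use x y in \<open>simp add: cutoff_eq_0\<close>)
    finally show ?thesis using far osc by simp
  qed
next
  case False
  then have out: "x \<notin> \<Omega> \<or> y \<notin> \<Omega>" using diam by blast
  then have "\<not> (x \<in> b2 \<and> y \<in> b2)" using b2_subset ball by auto
  then have osc: "log_oscillation (x, y) = 0" by (auto simp: log_oscillation_def indicator_def)
  have mid: "mid_kernel ?\<rho> = 0" using False r by (simp add: mid_kernel_def near_kernel_def far_kernel_def)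
  have far: "far_kernel d ?\<rho> = K ?\<rho>" using False by (simp add: far_kernel_def)
  have outside: "u w = 0 \<and> test w = 0 \<and> damping w = 0" if "w \<in> eucl N" "w \<notin> \<Omega>" "w \<notin> \<Omega> \<longrightarrow> u w = 0" for w
    using that ball cutoff_eq_0[of w] by (auto simp: test_def damping_def)
  have inside: "\<bar>u w\<bar> powr (p - 2) * u w * test w = damping w" if w: "w \<in> eucl N" "0 \<le> u w" for w
  proof (cases "w \<in> b3 \<and> u w \<noteq> 0")
    case True
    have "(u w / (\<delta> + u w)) powr (p - 1) = u w powr (p - 1) * (\<delta> + u w) powr (1 - p)"
      using True w \<delta> by (simp add: powr_divide powr_diff field_simps)
    moreover have "\<bar>u w\<bar> powr (p - 2) * u w = u w powr (p - 1)"
      using signed_powr[of "u w" p] True w by (simp add: sgn_if)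
    ultimately show ?thesis using True w by (simp add: test_def damping_def)
  next
    case False
    then show ?thesis using w cutoff_eq_0[OF w(1)] by (auto simp: test_def damping_def)
  qed
  from out have "?g = damping x + damping y"
  proof
    assume "x \<notin> \<Omega>"
    then show ?thesis using outside[of x] inside[of y] x y by simp
  next
    assume "y \<notin> \<Omega>"
    then show ?thesis using outside[of y] inside[of x] x y by simp
  qed
  then show ?thesis using mid far osc by (simp add: algebra_simps)
qed

text \<open>Integrate \<open>energy_pointwise\<close>. The middle part contributes \<open>far_mass r - far_mass d\<close> in addition
  to the near mass, and the damped far part contributes at most \<open>far_mass d\<close> because \<open>far_mass d > 0\<close>; so the two
  occurrences of \<open>far_mass d\<close> cancel.\<close>

lemma log_oscillation_energy:
  "(p - 1) / 2 * integral\<^sup>L leb2 log_oscillation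
    \<le> 2 * measure (leb N) b3 * (integral\<^sup>L (radial_measure N) (near_kernel r) + far_mass r)"
proof -
  define g where "g = (\<lambda>(x, y). \<bar>u x - u y\<bar> powr (p - 2) * (u x - u y) * (test x - test y) * K (edist N x y))"
  have "AE x in leb N. 0 \<le> test x" by (simp add: test_def)
  then have "0 \<le> J_form N s p u test"
    using super test_W0 by (auto simp: supersolution_def)
  then have J: "0 \<le> integral\<^sup>L leb2 g" by (simp add: J_form_def g_def)
  have gi: "integrable leb2 g" unfolding g_def by (rule J_form_integrable[OF u_W0 test_W0])
  note M = integral_radial_product[OF N mid_kernel_integral(1) b3_volume(1)]
  note F = integral_radial_product[OF N far_kernel_integrable(1)[OF d(1)] damping_integrable]
  let ?h = "\<lambda>z. ((case z of (x, y) \<Rightarrow> indicator b3 x * mid_kernel (edist N x y)) + (case z of (x, y) \<Rightarrow> indicator b3 y * mid_kernel (edist N x y)))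
      + ((case z of (x, y) \<Rightarrow> damping x * far_kernel d (edist N x y)) + (case z of (x, y) \<Rightarrow> damping y * far_kernel d (edist N x y)))
      - (p - 1) / 2 * log_oscillation z"
  note hi = Bochner_Integration.integrable_add[OF M(1,3)] Bochner_Integration.integrable_add[OF F(1,3)]
  note hi2 = Bochner_Integration.integrable_add[OF hi]
  note osc = integrable_mult_right[OF log_oscillation_integrable, of "(p - 1) / 2"]
  have "integral\<^sup>L leb2 g \<le> integral\<^sup>L leb2 ?h"
  proof (rule integral_mono_AE[OF gi])
    show "integrable leb2 ?h" by (rule Bochner_Integration.integrable_diff[OF hi2 osc])
    show "AE z in leb2. g z \<le> ?h z"
      using nonneg_pairs vanishing_outside AE_space
    proof eventually_elim
      case (elim z)
      obtain x y where z: "z = (x, y)" by (cases z)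
      show ?case using energy_pointwise[of x y] elim by (simp add: z g_def space_pair_measure space_leb)
    qed
  qed
  also have "integral\<^sup>L leb2 ?h = 2 * (measure (leb N) b3 * (integral\<^sup>L (radial_measure N) (near_kernel r) + far_mass r - far_mass d))
      + 2 * (integral\<^sup>L (leb N) damping * far_mass d) - (p - 1) / 2 * integral\<^sup>L leb2 log_oscillation"
    by (simp only: Bochner_Integration.integral_diff[OF hi2 osc] Bochner_Integration.integral_add[OF hi]
        Bochner_Integration.integral_add[OF M(1,3)] Bochner_Integration.integral_add[OF F(1,3)]
        M(2,4) F(2,4) far_kernel_integrable(2)[OF d(1)] mid_kernel_integral(2)) simp
  also have "integral\<^sup>L (leb N) damping * far_mass d \<le> measure (leb N) b3 * far_mass d"
  proof (intro mult_right_mono)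
    have "integral\<^sup>L (leb N) damping \<le> integral\<^sup>L (leb N) (indicator b3)"
      by (intro integral_mono damping_integrable b3_volume(1) damping_bounds)
    then show "integral\<^sup>L (leb N) damping \<le> measure (leb N) b3" by simp
  qed (use far_mass_pos in simp)
  finally show ?thesis
    using J by (simp only: right_diff_distrib mult.assoc) linarith
qed

end

section \<open>Uniformity of the constants\<close>

lemma Digamma_of_nat_le: "1 \<le> n \<Longrightarrow> Digamma (real n) \<le> real n"
proof (induction n rule: dec_induct)
  case base
  show ?case using euler_mascheroni_pos by simp
next
  case (step n)
  have "Digamma (real n + 1) = Digamma (real n) + 1 / real n"
    using step by (intro Digamma_plus1) auto
  moreover have "1 / real n \<le> 1" using step by simp
  moreover have Suc: "real (Suc n) = real n + 1" by simp
  ultimately show ?case unfolding Suc using step.IH by linarith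
qed

lemma Digamma_le_plus_1:
  fixes x :: real
  assumes "0 < x"
  shows "Digamma x \<le> x + 1"
proof -
  define n where "n = nat \<lceil>x\<rceil>"
  have n: "1 \<le> n" "x \<le> real n" "real n \<le> x + 1"
    using assms by (auto simp: n_def) linarith+
  have "Digamma x \<le> Digamma (real n)"
    using n assms Polygamma_real_strict_mono[of x "real n" 0] by (cases "x = real n") auto
  also have "\<dots> \<le> real n" by (rule Digamma_of_nat_le[OF n(1)])
  finally show ?thesis using n by simp
qed

text \<open>For \<open>s > 1/2\<close> the recurrence of the digamma function gives \<open>\<psi>(1 - s) \<le> 3 - 1/(1 - s)\<close>, and the other terms of \<open>B\<close> are bounded linearly
  in \<open>N\<close>; so \<open>B \<ge> 0\<close> leaves no room for a larger \<open>1/(1 - s)\<close>.\<close>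

lemma inverse_one_minus_s_le:
  assumes N: "1 \<le> N" and s: "0 < s" "s < 1" and p: "1 < p" and B: "0 \<le> B_const N s p"
  shows "1 / (1 - s) \<le> (8 + p + p\<^sup>2) * (real N + 1)"
proof -
  have big: "8 + p + p\<^sup>2 + (p * real N) \<le> (8 + p + p\<^sup>2) * (real N + 1)"
    using p N by (simp add: algebra_simps)
  have "1 / (1 - s) \<le> 8 + p + p\<^sup>2 + p * real N"
  proof (cases "s \<le> 1/2")
    case True
    then have "1 / (1 - s) \<le> 2" using s by (simp add: field_simps)
    moreover have "0 \<le> p * real N" using p by simp
    ultimately show ?thesis using p zero_le_power2[of p] by linarith
  next
    case False
    have "Digamma ((1 - s) + 1) = Digamma (1 - s) + 1 / (1 - s)"
      using s by (intro Digamma_plus1) auto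
    moreover have "Digamma ((1 - s) + 1) \<le> (1 - s) + 1 + 1"
      using s by (intro Digamma_le_plus_1) auto
    ultimately have D1: "Digamma (1 - s) \<le> 3 - 1 / (1 - s)" using s by linarith
    have "Digamma ((real N + s * p) / 2) \<le> (real N + s * p) / 2 + 1"
      using N s p by (intro Digamma_le_plus_1) (auto intro!: add_pos_pos)
    also have "\<dots> \<le> (real N + p) / 2 + 1"
      using s p by simp
    finally have "p / 2 * Digamma ((real N + s * p) / 2) \<le> p / 2 * ((real N + p) / 2 + 1)"
      using p by (intro mult_left_mono) auto
    also have "\<dots> \<le> p + p\<^sup>2 + p * real N"
      using p by (simp add: field_simps power2_eq_square)
    finally have D2: "p / 2 * Digamma ((real N + s * p) / 2) \<le> p + p\<^sup>2 + p * real N" .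
    have "1 / s \<le> 2" using False by (simp add: field_simps)
    moreover have "ln 2 \<le> (1::real)" using ln_le_minus_one[of 2] by simp
    ultimately show ?thesis using B D1 D2 unfolding B_const_def by linarith
  qed
  with big show ?thesis by linarith
qed

text \<open>Linear growth of \<open>1/(1 - s)\<close> in \<open>N\<close> is turned into \<open>(11/10)^N\<close> by the Bernoulli inequality, and \<open>3 * (11/10)^2 < 4\<close>.\<close>

lemma near_term_absorbed:
  assumes N: "1 \<le> N" and s: "0 < s" "s < 1" and p: "1 < p" and B: "0 \<le> B_const N s p"
  shows "3 ^ N * (1 / (1 - s))\<^sup>2 \<le> 100 * (8 + p + p\<^sup>2)\<^sup>2 * 4 ^ N"
proof -
  define D where "D = 8 + p + p\<^sup>2"
  have D: "0 < D" using p by (simp add: D_def add_pos_pos)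
  have "1 + real N * (1 / 10) \<le> (1 + 1 / 10) ^ N" by (rule Bernoulli_inequality) simp
  then have "real N + 1 \<le> 10 * (11 / 10) ^ N" by simp
  then have "D * (real N + 1) \<le> D * (10 * (11 / 10) ^ N)" using D by (intro mult_left_mono) auto
  with inverse_one_minus_s_le[OF assms] have "1 / (1 - s) \<le> D * (10 * (11 / 10) ^ N)"
    by (simp add: D_def)
  then have "(1 / (1 - s))\<^sup>2 \<le> (D * (10 * (11 / 10) ^ N))\<^sup>2"
    using s by (intro power_mono) auto
  also have "\<dots> = 100 * D\<^sup>2 * (121 / 100) ^ N"
    by (simp add: power_mult_distrib power2_eq_square flip: power_mult_distrib)
  finally have "3 ^ N * (1 / (1 - s))\<^sup>2 \<le> 3 ^ N * (100 * D\<^sup>2 * (121 / 100) ^ N)"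
    by (intro mult_left_mono) auto
  also have "\<dots> = 100 * D\<^sup>2 * (363 / 100) ^ N"
    by (simp flip: power_mult_distrib)
  also have "\<dots> \<le> 100 * D\<^sup>2 * 4 ^ N" by (intro mult_left_mono power_mono) auto
  finally show ?thesis by (simp add: D_def)
qed

context log_estimate
begin

text \<open>The condition \<open>4 r \<le> d\<close> gives \<open>Y = X - 1/s \<ge> 1\<close>. This makes the first term of the claim, a
  multiple of \<open>Y / (sp)\<close>, large enough to control \<open>X + 1/(1 - s)\<close> and hence the near mass.\<close>

lemma log_oscillation_bound:
  assumes r4: "4 * r \<le> d"
  shows "integral\<^sup>L leb2 log_oscillation
    \<le> 4 / (p - 1) * (1200 * (8 + p + p\<^sup>2)\<^sup>2 + 1) * r powr (real N - s * p)
      * (C_const N s p * (sphere_area N)\<^sup>2 * 2 ^ (2 * N)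
          * ((B_const N s p - p * ln r) / (s * p) - 1 / (s\<^sup>2 * p)))"
    and "0 \<le> C_const N s p * (sphere_area N)\<^sup>2 * 2 ^ (2 * N)
          * ((B_const N s p - p * ln r) / (s * p) - 1 / (s\<^sup>2 * p))"
    and "0 \<le> B_const N s p - p * ln (4 * r) + 1 / (1 - s)"
proof -
  define \<omega> V c Y E \<Lambda> M where "\<omega> = sphere_area N" and "V = unit_ball_vol (real N)" and "c = C_const N s p"
    and "Y = B_const N s p - p * ln r - 1 / s"
    and "E = (B_const N s p - p * ln r) / (s * p) - 1 / (s\<^sup>2 * p)"
    and "\<Lambda> = 1 / (1 - s)" and "M = 100 * (8 + p + p\<^sup>2)\<^sup>2"
  have pos: "0 < \<omega>" "0 < V" "0 < c"
    using sphere_area_pos[OF N] C_const_pos[OF N s p] by (simp_all add: \<omega>_def V_def c_def)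
  have V: "V \<le> \<omega>" using pos N by (simp add: \<omega>_def V_def sphere_area_unit_ball)
  have M: "0 \<le> M" by (simp add: M_def)
  have \<Lambda>: "1 \<le> \<Lambda>" using s by (simp add: \<Lambda>_def)
  have "ln (4 * r) \<le> ln d" using r4 r by simp
  then have ln4: "p * ln (4 * r) \<le> p * ln d" using p by simp
  have "1 / s > 0" using s by simp
  with ln4 show "0 \<le> B_const N s p - p * ln (4 * r) + 1 / (1 - s)"
    using minus_ln_d B s by (smt (verit) divide_pos_pos)
  have "1 \<le> ln (4::real)" using exp_le ln_ge_iff[of 4 1] by simp
  then have "p * 1 \<le> p * ln 4" using p by (intro mult_left_mono) auto
  moreover have "p * ln (4 * r) = p * ln 4 + p * ln r" using r by (simp add: ln_mult algebra_simps)
  ultimately have Y: "1 \<le> Y" unfolding Y_def using ln4 minus_ln_d B p by linarith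
  have E: "E = Y / (s * p)" using s p by (simp add: E_def Y_def field_simps power2_eq_square)
  have E0: "0 \<le> E" using E Y s p by simp
  have \<sigma>: "r powr (- (s * p)) * r ^ N = r powr (real N - s * p)"
    using r by (simp add: powr_diff powr_minus powr_realpow divide_inverse)
  have four: "(2::real) ^ (2 * N) = 4 ^ N" by (simp add: power_mult)
  show "0 \<le> C_const N s p * (sphere_area N)\<^sup>2 * 2 ^ (2 * N)
          * ((B_const N s p - p * ln r) / (s * p) - 1 / (s\<^sup>2 * p))"
    using pos E0 by (simp add: E_def \<omega>_def c_def)
  have "integral\<^sup>L (radial_measure N) (near_kernel r)
      \<le> \<omega> * c * r powr (- (s * p)) * (4 / (p * (1 - s))) * (B_const N s p - p * ln r + 1 / (1 - s))"
    using log_kernel_near(2)[OF N s p r(1) _ B] r d_less_1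
    by (simp add: near_kernel_def[abs_def] \<omega>_def c_def)
  also have "\<dots> = \<omega> * c * r powr (- (s * p)) * (4 * \<Lambda> / p * (Y + 1 / s + \<Lambda>))"
  proof -
    have "4 / (p * (1 - s)) = 4 * \<Lambda> / p" by (simp add: \<Lambda>_def mult.commute)
    moreover have "B_const N s p - p * ln r + 1 / (1 - s) = Y + 1 / s + \<Lambda>" by (simp add: Y_def \<Lambda>_def)
    ultimately show ?thesis by (simp only: mult.assoc)
  qed
  also have "\<dots> \<le> \<omega> * c * r powr (- (s * p)) * (12 * \<Lambda>\<^sup>2 * E)"
  proof (intro mult_left_mono)
    \<comment> \<open>\<open>\<Lambda>\<close>, \<open>Y\<close> and \<open>1/s\<close> are all at least \<open>1\<close>, so each summand is below their product\<close>
    have "1 / s \<le> \<Lambda> * Y / s" "\<Lambda> \<le> \<Lambda> * Y / s" "Y \<le> \<Lambda> * Y / s"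
    proof -
      have "1 \<le> \<Lambda> * Y" using mult_mono[of 1 \<Lambda> 1 Y] \<Lambda> Y by simp
      then show "1 / s \<le> \<Lambda> * Y / s" using s by (simp add: divide_right_mono)
      have le: "x \<le> x / s" if "0 \<le> x" for x using that s by (simp add: pos_le_divide_eq mult_left_le)
      have "\<Lambda> \<le> \<Lambda> * Y" using \<Lambda> Y by (simp add: mult_le_cancel_left1)
      also have "\<dots> \<le> \<Lambda> * Y / s" using \<Lambda> Y by (intro le) auto
      finally show "\<Lambda> \<le> \<Lambda> * Y / s" .
      have "Y \<le> \<Lambda> * Y" using \<Lambda> Y by (simp add: mult_le_cancel_right1)
      also have "\<dots> \<le> \<Lambda> * Y / s" using \<Lambda> Y by (intro le) auto
      finally show "Y \<le> \<Lambda> * Y / s" .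
    qed
    then have "Y + 1 / s + \<Lambda> \<le> \<Lambda> * Y / s + \<Lambda> * Y / s + \<Lambda> * Y / s" by (intro add_mono)
    then have "Y + 1 / s + \<Lambda> \<le> 3 * (\<Lambda> * Y / s)" by (simp add: mult.commute)
    then have "4 * \<Lambda> / p * (Y + 1 / s + \<Lambda>) \<le> 4 * \<Lambda> / p * (3 * (\<Lambda> * Y / s))"
      using \<Lambda> p by (intro mult_left_mono) auto
    also have "\<dots> = 12 * \<Lambda>\<^sup>2 * E" using s p by (simp add: E power2_eq_square mult_ac)
    finally show "4 * \<Lambda> / p * (Y + 1 / s + \<Lambda>) \<le> 12 * \<Lambda>\<^sup>2 * E" .
  qed (use pos in auto)
  finally have near: "integral\<^sup>L (radial_measure N) (near_kernel r) \<le> \<omega> * c * r powr (- (s * p)) * (12 * \<Lambda>\<^sup>2 * E)" .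
  have far: "far_mass r = \<omega> * c * r powr (- (s * p)) * E"
    by (simp add: far_mass_def \<omega>_def c_def E_def)
  have absorb: "3 ^ N * (12 * \<Lambda>\<^sup>2 + 1) \<le> 4 ^ N * (12 * M + 1)"
  proof -
    have "3 ^ N * \<Lambda>\<^sup>2 \<le> M * 4 ^ N" unfolding M_def \<Lambda>_def by (rule near_term_absorbed[OF N s p B])
    moreover have "(3::real) ^ N \<le> 4 ^ N" by (intro power_mono) auto
    ultimately show ?thesis by (simp add: algebra_simps)
  qed
  have "(p - 1) / 2 * integral\<^sup>L leb2 log_oscillation
      \<le> 2 * measure (leb N) b3 * (integral\<^sup>L (radial_measure N) (near_kernel r) + far_mass r)"
    by (rule log_oscillation_energy)
  also have "\<dots> \<le> 2 * measure (leb N) b3 * (\<omega> * c * r powr (- (s * p)) * ((12 * \<Lambda>\<^sup>2 + 1) * E))"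
    using near far by (intro mult_left_mono) (auto simp: algebra_simps)
  also have "\<dots> \<le> 2 * (\<omega> * (3 * r) ^ N) * (\<omega> * c * r powr (- (s * p)) * ((12 * \<Lambda>\<^sup>2 + 1) * E))"
  proof (intro mult_right_mono mult_left_mono)
    have "V * (3 * r) ^ N \<le> \<omega> * (3 * r) ^ N" using V r by (intro mult_right_mono) auto
    then show "measure (leb N) b3 \<le> \<omega> * (3 * r) ^ N" using b3_volume(2) unfolding V_def by linarith
  qed (use pos E0 in auto)
  also have "\<dots> = 2 * \<omega>\<^sup>2 * c * (r powr (- (s * p)) * r ^ N) * ((3 ^ N * (12 * \<Lambda>\<^sup>2 + 1)) * E)"
    by (simp only: power_mult_distrib power2_eq_square mult_ac)
  also have "\<dots> \<le> 2 * \<omega>\<^sup>2 * c * (r powr (- (s * p)) * r ^ N) * ((4 ^ N * (12 * M + 1)) * E)"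
    using absorb pos E0 r by (intro mult_left_mono mult_right_mono) auto
  finally have fin: "(p - 1) / 2 * integral\<^sup>L leb2 log_oscillation
      \<le> 2 * \<omega>\<^sup>2 * c * r powr (real N - s * p) * ((4 ^ N * (12 * M + 1)) * E)"
    unfolding \<sigma> .
  have "integral\<^sup>L leb2 log_oscillation = 2 / (p - 1) * ((p - 1) / 2 * integral\<^sup>L leb2 log_oscillation)"
    using p by simp
  also have "\<dots> \<le> 2 / (p - 1) * (2 * \<omega>\<^sup>2 * c * r powr (real N - s * p) * ((4 ^ N * (12 * M + 1)) * E))"
    using p by (intro mult_left_mono fin) auto
  also have "\<dots> = 4 / (p - 1) * (12 * M + 1) * r powr (real N - s * p) * (c * \<omega>\<^sup>2 * 2 ^ (2 * N) * E)"
    unfolding four by simp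
  finally show "integral\<^sup>L leb2 log_oscillation
    \<le> 4 / (p - 1) * (1200 * (8 + p + p\<^sup>2)\<^sup>2 + 1) * r powr (real N - s * p)
      * (C_const N s p * (sphere_area N)\<^sup>2 * 2 ^ (2 * N)
          * ((B_const N s p - p * ln r) / (s * p) - 1 / (s\<^sup>2 * p)))"
    by (simp add: M_def \<omega>_def c_def E_def)
qed

lemma log_oscillation_set_integral:
  "set_integrable leb2 (b2 \<times> b2) (\<lambda>(x, y). K (edist N x y) * \<bar>ln ((\<delta> + u x) / (\<delta> + u y))\<bar> powr p)"
  "(\<integral>y\<in>b2. (\<integral>x\<in>b2. K (edist N x y) * \<bar>ln ((\<delta> + u x) / (\<delta> + u y))\<bar> powr p \<partial>leb N) \<partial>leb N)
    = integral\<^sup>L leb2 log_oscillation"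
proof -
  interpret pair_sigma_finite "leb N" "leb N" by (rule pair_sigma_finite_leb)
  define f where "f = (\<lambda>x y. indicator (b2 \<times> b2) (x, y) * (K (edist N x y) * \<bar>ln ((\<delta> + u x) / (\<delta> + u y))\<bar> powr p))"
  have f: "log_oscillation = case_prod f" by (simp add: log_oscillation_def f_def)
  have "(\<lambda>z. indicator (b2 \<times> b2) z *\<^sub>R (case z of (x, y) \<Rightarrow> K (edist N x y) * \<bar>ln ((\<delta> + u x) / (\<delta> + u y))\<bar> powr p)) = log_oscillation"
    by (auto simp: log_oscillation_def)
  then show "set_integrable leb2 (b2 \<times> b2) (\<lambda>(x, y). K (edist N x y) * \<bar>ln ((\<delta> + u x) / (\<delta> + u y))\<bar> powr p)"
    using log_oscillation_integrable by (simp add: set_integrable_def)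
  have "(\<integral>y\<in>b2. (\<integral>x\<in>b2. K (edist N x y) * \<bar>ln ((\<delta> + u x) / (\<delta> + u y))\<bar> powr p \<partial>leb N) \<partial>leb N)
      = (\<integral>y. (\<integral>x. f x y \<partial>leb N) \<partial>leb N)"
    unfolding set_lebesgue_integral_def f_def
    by (intro Bochner_Integration.integral_cong refl) (auto simp: indicator_def)
  also have "\<dots> = integral\<^sup>L leb2 log_oscillation"
    unfolding f using log_oscillation_integrable by (intro integral_snd) (simp add: f)
  finally show "(\<integral>y\<in>b2. (\<integral>x\<in>b2. K (edist N x y) * \<bar>ln ((\<delta> + u x) / (\<delta> + u y))\<bar> powr p \<partial>leb N) \<partial>leb N)
    = integral\<^sup>L leb2 log_oscillation" .
qed

end

section \<open>The logarithmic estimate\<close>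

lemma point_at_distance:
  assumes N: "1 \<le> N" and x: "x \<in> eucl N" and t: "0 \<le> t"
  obtains y where "y \<in> eucl N" "edist N x y = t"
proof
  show "x(0 := x 0 + t) \<in> eucl N" using x N by (auto simp: eucl_def PiE_def extensional_def)
  have "(\<Sum>i<N. (x i - (x(0 := x 0 + t)) i)\<^sup>2) = (\<Sum>i<N. if i = 0 then t\<^sup>2 else 0)"
    by (intro sum.cong) auto
  also have "\<dots> = t\<^sup>2" using N by simp
  finally show "edist N x (x(0 := x 0 + t)) = t" using t by (simp add: edist_def L2_set_def)
qed

theorem lemma5p2:
  fixes p :: real
  assumes "1 < p"
  shows "\<exists>C>0. \<exists>c>0. \<forall>(N::nat) (s::real) (\<Omega>::(nat \<Rightarrow> real) set) x0 u R \<delta> r.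
    1 \<le> N \<longrightarrow> 0 < s \<longrightarrow> s < 1 \<longrightarrow>
    openin (eucl_top N) \<Omega> \<longrightarrow> ebounded N \<Omega> \<longrightarrow> lipschitz_boundary N \<Omega> \<longrightarrow>
    ediam N \<Omega> < exp (- 1 / (s * p)) \<longrightarrow> 0 \<le> B_const N s p \<longrightarrow>
    x0 \<in> \<Omega> \<longrightarrow> supersolution N s p \<Omega> u \<longrightarrow>
    0 < R \<longrightarrow> eucl_top N closure_of open_ball N x0 R \<subseteq> \<Omega> \<longrightarrow>
    (AE x in leb N. x \<in> open_ball N x0 R \<longrightarrow> 0 \<le> u x) \<longrightarrow>
    0 < \<delta> \<longrightarrow> \<delta> < 1 \<longrightarrow> 0 < r \<longrightarrow> open_ball N x0 (2 * r) \<subseteq> open_ball N x0 (R / 2) \<longrightarrow>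
    set_integrable (leb N \<Otimes>\<^sub>M leb N) (open_ball N x0 (2 * r) \<times> open_ball N x0 (2 * r))
      (\<lambda>(x, y). log_kernel N s p (edist N x y) * \<bar>ln ((\<delta> + u x) / (\<delta> + u y))\<bar> powr p) \<and>
    (\<integral>y\<in>open_ball N x0 (2 * r). (\<integral>x\<in>open_ball N x0 (2 * r).
        log_kernel N s p (edist N x y) * \<bar>ln ((\<delta> + u x) / (\<delta> + u y))\<bar> powr p \<partial>leb N) \<partial>leb N)
    \<le> C * r powr (real N - s * p) *
       (C_const N s p * (sphere_area N)\<^sup>2 * 2 ^ (2 * N)
          * ((B_const N s p - p * ln r) / (s * p) - 1 / (s\<^sup>2 * p))
        + sphere_area N * 2 ^ N *
            (\<integral>y\<in>eucl N - open_ball N x0 R.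
               max 0 (log_kernel N s p (1 / 2 * edist N y x0)) * max 0 (- u y) powr (p - 1) \<partial>leb N)
        + c * C_const N s p * ((sphere_area N)\<^sup>2 / (real N * p * (1 - s)))
          * 2 powr (real N + 2 * p * (1 - s))
          * (B_const N s p - p * ln (4 * r) + 1 / (1 - s)))"
proof -
  define A where "A = 4 / (p - 1) * (1200 * (8 + p + p\<^sup>2)\<^sup>2 + 1)"
  have A: "0 < A" using assms by (simp add: A_def add_nonneg_pos)
  show ?thesis
  \<comment> \<open>any positive constant serves for the third term, which is only used through its sign\<close>
  proof (rule exI[of _ A], rule conjI[OF A], rule exI[of _ 1], rule conjI[OF zero_less_one], intro allI impI)
    fix N :: nat and s :: real and \<Omega> :: "(nat \<Rightarrow> real) set" and x0 :: "nat \<Rightarrow> real"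
      and u :: "(nat \<Rightarrow> real) \<Rightarrow> real" and R \<delta> r :: real
    assume N: "1 \<le> N" and s: "0 < s" "s < 1" and \<Omega>: "openin (eucl_top N) \<Omega>" "ebounded N \<Omega>"
      and diam: "ediam N \<Omega> < exp (- 1 / (s * p))" and B: "0 \<le> B_const N s p"
      and x0: "x0 \<in> \<Omega>" and super: "supersolution N s p \<Omega> u"
      and R: "0 < R" "eucl_top N closure_of open_ball N x0 R \<subseteq> \<Omega>"
      and \<delta>: "0 < \<delta>" and r: "0 < r" "open_ball N x0 (2 * r) \<subseteq> open_ball N x0 (R / 2)"
    have top: "topspace (eucl_top N) = eucl N" by (simp add: eucl_top_def eucl_def)
    have x0N: "x0 \<in> eucl N" using openin_subset[OF \<Omega>(1)] x0 by (auto simp: top)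
    have "open_ball N x0 R \<subseteq> eucl_top N closure_of open_ball N x0 R"
      by (rule closure_of_subset) (auto simp: top open_ball_def)
    with R have ballR: "open_ball N x0 R \<subseteq> \<Omega>" by blast
    have rR: "4 * r \<le> R"
    proof (rule ccontr)
      assume "\<not> 4 * r \<le> R"
      moreover obtain y where "y \<in> eucl N" "edist N x0 y = R / 2"
        using point_at_distance[OF N x0N, of "R / 2"] R by auto
      ultimately have "y \<in> open_ball N x0 (2 * r)" "y \<notin> open_ball N x0 (R / 2)"
        by (auto simp: open_ball_def)
      with r(2) show False by blast
    qed
    obtain b where b: "\<forall>x\<in>\<Omega>. \<forall>y\<in>\<Omega>. edist N x y \<le> b" using \<Omega>(2) by (auto simp: ebounded_def)
    have ediam: "edist N x y \<le> ediam N \<Omega>" if "x \<in> \<Omega>" "y \<in> \<Omega>" for x y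
    proof -
      have "bdd_above ((\<lambda>(x, y). edist N x y) ` (\<Omega> \<times> \<Omega>))" using b by (auto intro!: bdd_aboveI)
      then have "(\<lambda>(x, y). edist N x y) (x, y) \<le> ediam N \<Omega>"
        unfolding ediam_def using that by (intro cSUP_upper) auto
      then show ?thesis by simp
    qed
    have diam0: "0 \<le> ediam N \<Omega>" using ediam[OF x0 x0] by simp
    have Rdiam: "R \<le> ediam N \<Omega>"
    proof (rule ccontr)
      assume *: "\<not> R \<le> ediam N \<Omega>"
      obtain y where y: "y \<in> eucl N" "edist N x0 y = (ediam N \<Omega> + R) / 2"
        using point_at_distance[OF N x0N, of "(ediam N \<Omega> + R) / 2"] R diam0 by auto
      then have "y \<in> \<Omega>" using ballR * by (auto simp: open_ball_def)
      then show False using ediam[OF x0] y * by fastforce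
    qed
    \<comment> \<open>strictly between the diameter and the admissible bound\<close>
    define d where "d = (ediam N \<Omega> + exp (- 1 / (s * p))) / 2"
    have d: "0 < d" "d < exp (- 1 / (s * p))" "ediam N \<Omega> < d"
      using diam diam0 by (simp_all add: d_def)
    have r4: "4 * r \<le> d" using rR Rdiam d by linarith
    interpret log_estimate N s p \<Omega> u d x0 r \<delta>
    proof
      show "edist N x y < d" if "x \<in> \<Omega>" "y \<in> \<Omega>" for x y using ediam[OF that] d by simp
      show "open_ball N x0 (3 * r) \<subseteq> \<Omega>" using ballR rR r by (auto simp: open_ball_def)
      show "r \<le> d" using rR Rdiam d r by linarith
    qed (use N s assms B super d x0N r \<delta> in auto)
    note bound = log_oscillation_bound[OF r4]
    let ?E = "C_const N s p * (sphere_area N)\<^sup>2 * 2 ^ (2 * N) * ((B_const N s p - p * ln r) / (s * p) - 1 / (s\<^sup>2 * p))"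
    let ?T = "sphere_area N * 2 ^ N * (\<integral>y\<in>eucl N - open_ball N x0 R.
               max 0 (log_kernel N s p (1 / 2 * edist N y x0)) * max 0 (- u y) powr (p - 1) \<partial>leb N)"
    let ?F = "1 * C_const N s p * ((sphere_area N)\<^sup>2 / (real N * p * (1 - s))) * 2 powr (real N + 2 * p * (1 - s))
          * (B_const N s p - p * ln (4 * r) + 1 / (1 - s))"
    have T: "0 \<le> ?T" unfolding set_lebesgue_integral_def
      using sphere_area_pos[OF N] by (intro mult_nonneg_nonneg Bochner_Integration.integral_nonneg) auto
    have F: "0 \<le> ?F"
      using bound(3) C_const_pos[OF N s assms] s assms by (intro mult_nonneg_nonneg) auto
    have "integral\<^sup>L leb2 log_oscillation \<le> A * r powr (real N - s * p) * ?E"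
      using bound(1) by (simp add: A_def)
    also have "\<dots> \<le> A * r powr (real N - s * p) * (?E + ?T + ?F)"
      using A T F by (intro mult_left_mono) auto
    finally show "set_integrable (leb N \<Otimes>\<^sub>M leb N) (open_ball N x0 (2 * r) \<times> open_ball N x0 (2 * r))
      (\<lambda>(x, y). log_kernel N s p (edist N x y) * \<bar>ln ((\<delta> + u x) / (\<delta> + u y))\<bar> powr p) \<and>
    (\<integral>y\<in>open_ball N x0 (2 * r). (\<integral>x\<in>open_ball N x0 (2 * r).
        log_kernel N s p (edist N x y) * \<bar>ln ((\<delta> + u x) / (\<delta> + u y))\<bar> powr p \<partial>leb N) \<partial>leb N)
    \<le> A * r powr (real N - s * p) * (?E + ?T + ?F)"
      using log_oscillation_set_integral by simp
  qed
qed

end
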